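(* Let $(S,\mathcal{C})$ be a connected connectoid and let $U\subseteq S$. Then there is a normal tree of $(S,\mathcal{C})$ containing $U$ if and only if for every end $\omega\in\Omega(S,\mathcal{C})$ there is a finite set $X_\omega\subseteq S$ such that the induced subconnectoid of $(S,\mathcal{C})$ on $K(X_\omega,\omega)$ has a normal tree containing $U\cap K(X_\omega,\omega)$.
   Context: Connectoids: let $S$ be a set and let $\mathcal{F}$ be a set of finite subsets of $S$ such that (i) $F\cup F'\in\mathcal{F}$ whenever $F,F'\in\mathcal{F}$ and $F\cap F'\neq\emptyset$, and (ii) $\emptyset\in\mathcal{F}$ and $\{s\}\in\mathcal{F}$ for every $s\in S$. A subset $C\subseteq S$ is connected if for every $x,y\in C$ there is $F\in\mathcal{F}$ with $F\subseteq C$ and $x,y\in F$. The pair $(S,\mathcal{C})$, where $\mathcal{C}$ is the set of connected subsets of $S$, is the connectoid induced by $\mathcal{F}$; a connectoid is any pair arising in this way. It is connected if $S\in\mathcal{C}$. For $S'\subseteq S$, a component of $S'$ is a maximal connected subset of $S'$, and $\mathcal{K}(S')$ is the set of components of $S'$. The induced subconnectoid on $S'\subseteq S$ is the connectoid $(S',\{C\in\mathcal{C}: C\subseteq S'\})$. Necklaces: with $\mathbb{N}=\{1,2,3,\dots\}$, a connected set $N$ is a necklace if there is a family $(H_n)_{n\in\mathbb{N}}$ of finite connected sets with $N=\bigcup_{n}H_n$ such that, for all $i,j\in\mathbb{N}$, $H_i\cap H_j\neq\emptyset$ if and only if $|i-j|\leq 1$. Ends: for a necklace $N$ and a finite set $X\subseteq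 S$ there is a unique component of $N\setminus X$ containing all but finitely many elements of $N$, called the $X$-tail of $N$. Two necklaces $N,N'$ are equivalent if for every finite $X\subseteq S$ the $X$-tails of $N$ and $N'$ are contained in the same component in $\mathcal{K}(S\setminus X)$. The equivalence classes are the ends of $(S,\mathcal{C})$, and $\Omega(S,\mathcal{C})$ is the set of ends. For a finite set $X\subseteq S$ and an end $\omega$, $K(X,\omega)$ is the unique component in $\mathcal{K}(S\setminus X)$ that contains a necklace belonging to $\omega$. Normal trees: $\leq_T$ denotes the tree-order of a rooted tree $T$. A weak normal tree of a connectoid $(S,\mathcal{C})$ is a rooted undirected tree $T$ with $V(T)\subseteq S$ such that (a) for every $C\in\mathcal{C}$ and every two $\leq_T$-incomparable $u,v\in C\cap V(T)$ there is $w\in C$ with $w\leq_T u,v$, and (b) for every $u\leq_T v$ in $V(T)$ there is $C\in\mathcal{C}$ with $u,v\in C$ that contains no $w<_T u$. A weak normal tree $T$ is a normal tree if moreover for every ray $R$ in $T$ starting at the root there is a necklace of $(S,\mathcal{C})$ containing all but finitely many elements of $V(R)$. A tree contains $U$ if $U\subseteq V(T)$. *)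

theory Defs
  imports Main
begin

section \<open>Connectoids\<close>

definition connectoid_base :: "'a set \<Rightarrow> 'a set set \<Rightarrow> bool" where
  "connectoid_base S \<F> \<longleftrightarrow>
     (\<forall>F\<in>\<F>. finite F \<and> F \<subseteq> S) \<and>
     (\<forall>F\<in>\<F>. \<forall>F'\<in>\<F>. F \<inter> F' \<noteq> {} \<longrightarrow> F \<union> F' \<in> \<F>) \<and>
     {} \<in> \<F> \<and> (\<forall>s\<in>S. {s} \<in> \<F>)"

definition induced_connected_sets :: "'a set \<Rightarrow> 'a set set \<Rightarrow> 'a set set" where
  "induced_connected_sets S \<F> =
     {C. C \<subseteq> S \<and> (\<forall>x\<in>C. \<forall>y\<in>C. \<exists>F\<in>\<F>. F \<subseteq> C \<and> x \<in> F \<and> y \<in> F)}"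

text \<open>A connectoid is given by its ground set and its set of connected sets.\<close>

definition connectoid :: "'a set \<Rightarrow> 'a set set \<Rightarrow> bool" where
  "connectoid S \<C> \<longleftrightarrow> (\<exists>\<F>. connectoid_base S \<F> \<and> \<C> = induced_connected_sets S \<F>)"

definition connected_connectoid :: "'a set \<Rightarrow> 'a set set \<Rightarrow> bool" where
  "connected_connectoid S \<C> \<longleftrightarrow> connectoid S \<C> \<and> S \<in> \<C>"

definition ctd_components :: "'a set set \<Rightarrow> 'a set \<Rightarrow> 'a set set" where
  "ctd_components \<C> S' =
     {K. K \<in> \<C> \<and> K \<subseteq> S' \<and> (\<forall>K'\<in>\<C>. K' \<subseteq> S' \<and> K \<subseteq> K' \<longrightarrow> K' = K)}"

text \<open>The connected sets of the induced subconnectoid on \<open>S'\<close>, whose ground set is \<open>S'\<close>.\<close>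

definition sub_connected_sets :: "'a set set \<Rightarrow> 'a set \<Rightarrow> 'a set set" where
  "sub_connected_sets \<C> S' = {C\<in>\<C>. C \<subseteq> S'}"


section \<open>Necklaces and ends\<close>

text \<open>The bead families are indexed from 0 rather than from 1; only differences of indices matter.\<close>

definition necklace :: "'a set set \<Rightarrow> 'a set \<Rightarrow> bool" where
  "necklace \<C> N \<longleftrightarrow> N \<in> \<C> \<and>
     (\<exists>H :: nat \<Rightarrow> 'a set.
        (\<forall>n. finite (H n) \<and> H n \<in> \<C>) \<and> N = (\<Union>n. H n) \<and>
        (\<forall>i j. H i \<inter> H j \<noteq> {} \<longleftrightarrow> \<bar>int i - int j\<bar> \<le> 1))"

definition necklace_tail :: "'a set set \<Rightarrow> 'a set \<Rightarrow> 'a set \<Rightarrow> 'a set" where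
  "necklace_tail \<C> X N = (THE K. K \<in> ctd_components \<C> (N - X) \<and> finite (N - K))"

definition necklace_equiv :: "'a set \<Rightarrow> 'a set set \<Rightarrow> ('a set \<times> 'a set) set" where
  "necklace_equiv S \<C> =
     {(N, N'). necklace \<C> N \<and> necklace \<C> N' \<and>
        (\<forall>X. finite X \<and> X \<subseteq> S \<longrightarrow>
           (\<exists>K \<in> ctd_components \<C> (S - X).
              necklace_tail \<C> X N \<subseteq> K \<and> necklace_tail \<C> X N' \<subseteq> K))}"

definition ctd_ends :: "'a set \<Rightarrow> 'a set set \<Rightarrow> 'a set set set" where
  "ctd_ends S \<C> = {N. necklace \<C> N} // necklace_equiv S \<C>"

definition end_component :: "'a set \<Rightarrow> 'a set set \<Rightarrow> 'a set \<Rightarrow> 'a set set \<Rightarrow> 'a set" where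
  "end_component S \<C> X \<omega> = (THE K. K \<in> ctd_components \<C> (S - X) \<and> (\<exists>N\<in>\<omega>. N \<subseteq> K))"


section \<open>Rooted trees\<close>

text \<open>
  Simple undirected graphs, possibly infinite, with edges as two-element vertex sets.  The trees
  of the AFP entry on graph theory are digraphs without directed cycles; a symmetric digraph with
  an edge is never one of them.
\<close>

definition simple_graph :: "'a set \<Rightarrow> 'a set set \<Rightarrow> bool" where
  "simple_graph V E \<longleftrightarrow> (\<forall>e\<in>E. \<exists>u\<in>V. \<exists>v\<in>V. u \<noteq> v \<and> e = {u, v})"

definition graph_path :: "'a set \<Rightarrow> 'a set set \<Rightarrow> 'a list \<Rightarrow> bool" where
  "graph_path V E p \<longleftrightarrow> p \<noteq> [] \<and> set p \<subseteq> V \<and> distinct p \<and>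
     (\<forall>i. Suc i < length p \<longrightarrow> {p ! i, p ! Suc i} \<in> E)"

definition graph_cycle :: "'a set \<Rightarrow> 'a set set \<Rightarrow> 'a list \<Rightarrow> bool" where
  "graph_cycle V E p \<longleftrightarrow> graph_path V E p \<and> 3 \<le> length p \<and> {last p, hd p} \<in> E"

definition rooted_tree :: "'a set \<Rightarrow> 'a set set \<Rightarrow> 'a \<Rightarrow> bool" where
  "rooted_tree V E r \<longleftrightarrow> simple_graph V E \<and> r \<in> V \<and>
     (\<forall>u\<in>V. \<forall>v\<in>V. \<exists>p. graph_path V E p \<and> hd p = u \<and> last p = v) \<and>
     \<not> (\<exists>p. graph_cycle V E p)"

text \<open>
  \<open>u\<close> is below \<open>v\<close> in the tree-order if \<open>u\<close> lies on the path (unique in a tree) from the root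
  \<open>r\<close> to \<open>v\<close>.  In particular \<open>u\<close> and \<open>v\<close> are then vertices.
\<close>

definition tree_le :: "'a set \<Rightarrow> 'a set set \<Rightarrow> 'a \<Rightarrow> 'a \<Rightarrow> 'a \<Rightarrow> bool" where
  "tree_le V E r u v \<longleftrightarrow> (\<exists>p. graph_path V E p \<and> hd p = r \<and> last p = v \<and> u \<in> set p)"

definition ray_from :: "'a set \<Rightarrow> 'a set set \<Rightarrow> 'a \<Rightarrow> (nat \<Rightarrow> 'a) \<Rightarrow> bool" where
  "ray_from V E r R \<longleftrightarrow> R 0 = r \<and> inj R \<and> range R \<subseteq> V \<and> (\<forall>n. {R n, R (Suc n)} \<in> E)"


section \<open>Normal trees\<close>

definition weak_normal_tree ::
    "'a set \<Rightarrow> 'a set set \<Rightarrow> 'a set \<Rightarrow> 'a set set \<Rightarrow> 'a \<Rightarrow> bool" where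
  "weak_normal_tree S \<C> V E r \<longleftrightarrow> rooted_tree V E r \<and> V \<subseteq> S \<and>
     (\<forall>C\<in>\<C>. \<forall>u\<in>C \<inter> V. \<forall>v\<in>C \<inter> V. \<not> tree_le V E r u v \<and> \<not> tree_le V E r v u \<longrightarrow>
        (\<exists>w\<in>C. tree_le V E r w u \<and> tree_le V E r w v)) \<and>
     (\<forall>u\<in>V. \<forall>v\<in>V. tree_le V E r u v \<longrightarrow>
        (\<exists>C\<in>\<C>. u \<in> C \<and> v \<in> C \<and> \<not> (\<exists>w\<in>C. tree_le V E r w u \<and> w \<noteq> u)))"

definition normal_tree ::
    "'a set \<Rightarrow> 'a set set \<Rightarrow> 'a set \<Rightarrow> 'a set set \<Rightarrow> 'a \<Rightarrow> bool" where
  "normal_tree S \<C> V E r \<longleftrightarrow> weak_normal_tree S \<C> V E r \<and>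
     (\<forall>R. ray_from V E r R \<longrightarrow> (\<exists>N. necklace \<C> N \<and> finite (range R - N)))"

definition has_normal_tree_containing :: "'a set \<Rightarrow> 'a set set \<Rightarrow> 'a set \<Rightarrow> bool" where
  "has_normal_tree_containing S \<C> U \<longleftrightarrow> (\<exists>V E r. normal_tree S \<C> V E r \<and> U \<subseteq> V)"

end

theory Submission
  imports Defs "HOL-Library.Nat_Bijection"
begin

text \<open>
  Call a set dispersed if every necklace can be separated from it by deleting a finite set, and
  sigma-dispersed if it is covered by countably many dispersed sets.

  The levels of a weak normal tree are dispersed, since a necklace can climb the tree only along one
  branch.  Hence \<open>U\<close> is sigma-dispersed near every end.  If \<open>U\<close> were not sigma-dispersed, one could follow
  components of complements of finite sets in which \<open>U\<close> is not sigma-dispersed; the finite sets can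
  be chosen so well that the resulting necklace violates the hypothesis at its end.  Finally a
  sigma-dispersed set is caught by a normal tree that is built vertex by vertex, always serving the
  dispersed set of least index that meets the current component, and queueing the elements of finite connected
  sets between consecutive vertices so that these sets form a necklace along every ray.
\<close>

section \<open>Connected sets, components and necklaces\<close>

text \<open>Deleting a finite set may leave uncountably many components, so sigma-dispersed traces
  in the components cannot simply be united. They combine nevertheless, because a necklace has
  almost all of its points in at most one of the components. Hence a region in which the trace of
  \<open>U\<close> is not sigma-dispersed passes this defect on to some component, and the descent
  never stops. Descent alone gives no contradiction. The finite set that the hypothesis provides for
  the end of the necklace may contain points lying in all regions of the descent, and deleting these
  could leave the tail of the necklace in a part where \<open>U\<close> is sigma-dispersed. The sets
  called traps below are chosen to exclude exactly this. In the construction of the tree, the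
  necklaces along the rays serve a second purpose: a point of \<open>U\<close> that stayed in all
  regions of a branch would force points of one fixed dispersed set to occur all along the necklace
  of that branch. This is why the order in which the dispersed sets are served matters.\<close>

locale connectoid_space =
  fixes S :: "'a set" and \<C> :: "'a set set"
  assumes connected_subset: "C \<in> \<C> \<Longrightarrow> C \<subseteq> S"
    and singleton_connected: "s \<in> S \<Longrightarrow> {s} \<in> \<C>"
    and Union_connected: "\<A> \<subseteq> \<C> \<Longrightarrow> (\<And>C. C \<in> \<A> \<Longrightarrow> x \<in> C) \<Longrightarrow> \<Union>\<A> \<in> \<C>"
    and finite_connected_witness:
      "C \<in> \<C> \<Longrightarrow> x \<in> C \<Longrightarrow> y \<in> C \<Longrightarrow> \<exists>F\<in>\<C>. finite F \<and> F \<subseteq> C \<and> x \<in> F \<and> y \<in> F"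

text \<open>All later arguments use only these consequences of a generating family
  \<open>\<F>\<close>, with its members replaced by finite connected sets. In this form the axioms
  pass directly to induced subconnectoids, for which no generating family has to be
  exhibited.\<close>

lemma connectoid_space_connectoid:
  assumes "connectoid S \<C>"
  shows "connectoid_space S \<C>"
proof -
  obtain \<F> where base: "connectoid_base S \<F>" and C: "\<C> = induced_connected_sets S \<F>"
    using assms by (auto simp: connectoid_def)
  have fin: "finite F" "F \<subseteq> S" if "F \<in> \<F>" for F
    using base that by (auto simp: connectoid_base_def)
  have un: "F \<union> F' \<in> \<F>" if "F \<in> \<F>" "F' \<in> \<F>" "x \<in> F" "x \<in> F'" for F F' x
    using base that unfolding connectoid_base_def by blast
  have FC: "\<F> \<subseteq> \<C>"
    using fin by (auto simp: C induced_connected_sets_def)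
  show ?thesis
  proof
    show "C \<subseteq> S" if "C \<in> \<C>" for C
      using that by (auto simp: C induced_connected_sets_def)
    show "{s} \<in> \<C>" if "s \<in> S" for s
      using that base FC by (auto simp: connectoid_base_def)
    show "\<Union>\<A> \<in> \<C>" if A: "\<A> \<subseteq> \<C>" and x: "\<And>C. C \<in> \<A> \<Longrightarrow> x \<in> C" for \<A> x
      unfolding C induced_connected_sets_def
    proof (intro CollectI conjI ballI)
      show "\<Union>\<A> \<subseteq> S"
        using A by (auto simp: C induced_connected_sets_def)
      fix y z assume "y \<in> \<Union>\<A>" "z \<in> \<Union>\<A>"
      then obtain Cy Cz where Cy: "Cy \<in> \<A>" "y \<in> Cy" and Cz: "Cz \<in> \<A>" "z \<in> Cz"
        by blast
      obtain F where F: "F \<in> \<F>" "F \<subseteq> Cy" "y \<in> F" "x \<in> F"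
        using Cy x A unfolding C induced_connected_sets_def by blast
      obtain G where G: "G \<in> \<F>" "G \<subseteq> Cz" "x \<in> G" "z \<in> G"
        using Cz x A unfolding C induced_connected_sets_def by blast
      show "\<exists>F\<in>\<F>. F \<subseteq> \<Union>\<A> \<and> y \<in> F \<and> z \<in> F"
        using un[OF F(1) G(1) F(4) G(3)] F G Cy Cz by (intro bexI[of _ "F \<union> G"]) auto
    qed
    show "\<exists>F\<in>\<C>. finite F \<and> F \<subseteq> C \<and> x \<in> F \<and> y \<in> F" if that_C: "C \<in> \<C>" "x \<in> C" "y \<in> C" for C x y
    proof -
      obtain F where F: "F \<in> \<F>" "F \<subseteq> C" "x \<in> F" "y \<in> F"
        using that_C by (simp add: C induced_connected_sets_def) metis
      then show ?thesis
        using fin(1)[OF F(1)] FC by (intro bexI[of _ F]) auto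
    qed
  qed
qed

context connectoid_space
begin

abbreviation comps :: "'a set \<Rightarrow> 'a set set" where
  "comps \<equiv> ctd_components \<C>"

lemma Un_connected:
  assumes "C \<in> \<C>" "C' \<in> \<C>" "C \<inter> C' \<noteq> {}"
  shows "C \<union> C' \<in> \<C>"
proof -
  obtain x where "x \<in> C" "x \<in> C'"
    using assms(3) by blast
  then show ?thesis
    using Union_connected[of "{C, C'}" x] assms by auto
qed

lemma finite_connected_superset:
  assumes "C \<in> \<C>" "finite A" "A \<subseteq> C" "C \<noteq> {}"
  obtains F where "F \<in> \<C>" "finite F" "A \<subseteq> F" "F \<subseteq> C" "F \<noteq> {}"
proof -
  obtain x where x: "x \<in> C"
    using assms(4) by blast
  have "\<forall>a\<in>A. \<exists>F\<in>\<C>. finite F \<and> F \<subseteq> C \<and> x \<in> F \<and> a \<in> F"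
    using finite_connected_witness[OF assms(1) x] assms(3) by blast
  then obtain f where f: "\<And>a. a \<in> A \<Longrightarrow> f a \<in> \<C> \<and> finite (f a) \<and> f a \<subseteq> C \<and> x \<in> f a \<and> a \<in> f a"
    by metis
  \<comment> \<open>The singleton keeps the union nonempty when \<open>A\<close> is empty.\<close>
  have x1: "{x} \<in> \<C>"
    using singleton_connected connected_subset assms(1) x by blast
  have "\<Union>(insert {x} (f ` A)) \<in> \<C>"
    by (rule Union_connected[of _ x]) (use f x1 in auto)
  then show thesis
    by (rule that) (use f x assms(2) in auto)
qed

lemma component_connected: "K \<in> comps A \<Longrightarrow> K \<in> \<C>"
  and component_subset: "K \<in> comps A \<Longrightarrow> K \<subseteq> A"
  by (auto simp: ctd_components_def)

lemma component_absorbs: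
  assumes "K \<in> comps A" "C \<in> \<C>" "C \<subseteq> A" "C \<inter> K \<noteq> {}"
  shows "C \<subseteq> K"
proof -
  have "K \<union> C \<in> \<C>"
    using Un_connected assms component_connected by blast
  then have "K \<union> C = K"
    using assms by (auto simp: ctd_components_def)
  then show ?thesis
    by blast
qed

lemma component_eqI:
  assumes "K \<in> comps A" "K' \<in> comps A" "K \<inter> K' \<noteq> {}"
  shows "K = K'"
  using assms component_absorbs[of K A K'] component_absorbs[of K' A K]
    component_connected component_subset by blast

lemma component_of_connected:
  assumes "C \<in> \<C>" "C \<subseteq> A" "C \<noteq> {}"
  obtains K where "K \<in> comps A" "C \<subseteq> K"
proof -
  obtain x where x: "x \<in> C"
    using assms by blast
  define K where "K = \<Union>{C\<in>\<C>. C \<subseteq> A \<and> x \<in> C}"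
  have "K \<in> \<C>"
    unfolding K_def by (rule Union_connected[of _ x]) auto
  moreover have "C \<subseteq> K"
    using assms x by (auto simp: K_def)
  moreover have "K' = K" if "K' \<in> \<C>" "K' \<subseteq> A" "K \<subseteq> K'" for K'
  proof -
    have "x \<in> K'"
      using that x \<open>C \<subseteq> K\<close> by blast
    then have "K' \<subseteq> K"
      using that by (auto simp: K_def)
    then show ?thesis
      using that by blast
  qed
  ultimately show thesis
    using that[of K] by (auto simp: ctd_components_def K_def)
qed

lemma component_of_point:
  assumes "A \<subseteq> S" "x \<in> A"
  obtains K where "K \<in> comps A" "x \<in> K"
proof -
  have "{x} \<in> \<C>"
    using singleton_connected assms by blast
  then obtain K where "K \<in> comps A" "{x} \<subseteq> K"
    using component_of_connected[of "{x}" A] assms by auto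
  then show thesis
    using that by simp
qed

text \<open>A point of \<open>K\<close> pulls every larger connected set into \<open>D\<close>. If
  \<open>Y\<close> swallows \<open>D\<close>, the only component of \<open>D - Y\<close> is the
  empty set, which offers no such point.\<close>

lemma component_Diff:
  assumes D: "D \<in> comps (S - X)" and K: "K \<in> comps (D - Y)" "K \<noteq> {}"
  shows "K \<in> comps (S - (X \<union> Y))"
  unfolding ctd_components_def
proof (intro CollectI conjI ballI impI)
  show "K \<in> \<C>" "K \<subseteq> S - (X \<union> Y)"
    using component_connected component_subset D K(1) by blast+
  fix K' assume K': "K' \<in> \<C>" "K' \<subseteq> S - (X \<union> Y) \<and> K \<subseteq> K'"
  have "K' \<inter> D \<noteq> {}"
    using K' K component_subset[OF K(1)] by blast
  then have "K' \<subseteq> D - Y"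
    using component_absorbs[OF D K'(1)] K' by blast
  then show "K' = K"
    using K K' by (auto simp: ctd_components_def)
qed

lemma connected_atLeastAtMost_chain:
  assumes "\<And>n. J n \<in> \<C>" "\<And>n. J n \<inter> J (Suc n) \<noteq> {}" "a \<le> b"
  shows "(\<Union>i\<in>{a..b::nat}. J i) \<in> \<C>"
  using assms(3)
proof (induction b rule: dec_induct)
  case base
  then show ?case using assms(1) by simp
next
  case (step b)
  have "{a..Suc b} = insert (Suc b) {a..b}"
    using step by auto
  then have "(\<Union>i\<in>{a..Suc b}. J i) = (\<Union>i\<in>{a..b}. J i) \<union> J (Suc b)"
    by auto
  moreover have "(\<Union>i\<in>{a..b}. J i) \<inter> J (Suc b) \<noteq> {}"
    using assms(2)[of b] step by fastforce
  ultimately show ?case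
    using Un_connected step.IH assms(1) by metis
qed

lemma connected_chain:
  assumes "\<And>n. J n \<in> \<C>" "\<And>n. J n \<inter> J (Suc n) \<noteq> {}"
  shows "(\<Union>n::nat. J n) \<in> \<C>"
proof -
  obtain x where x: "x \<in> J 0"
    using assms(2)[of 0] by blast
  have "\<Union>(range (\<lambda>b. \<Union>i\<in>{0..b}. J i)) \<in> \<C>"
    by (rule Union_connected[of _ x])
      (use x connected_atLeastAtMost_chain[of J 0, OF assms] in auto)
  moreover have "\<Union>(range (\<lambda>b. \<Union>i\<in>{0..b}. J i)) = (\<Union>n. J n)"
    by force
  ultimately show ?thesis
    by simp
qed

section \<open>Necklaces: discarding beads, and regrouping chains into necklaces\<close>

lemma necklace_connected: "necklace \<C> N \<Longrightarrow> N \<in> \<C>"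
  by (simp add: necklace_def)

lemma necklace_subset: "necklace \<C> N \<Longrightarrow> N \<subseteq> S"
  using necklace_connected connected_subset by blast

text \<open>Beads of even index are nonempty and pairwise disjoint, so one point from each gives
  infinitely many.\<close>

lemma infinite_necklace:
  assumes "necklace \<C> N"
  shows "infinite N"
proof
  assume fin: "finite N"
  obtain H :: "nat \<Rightarrow> 'a set" where N: "N = (\<Union>n. H n)"
    and H: "\<And>i j. H i \<inter> H j \<noteq> {} \<longleftrightarrow> \<bar>int i - int j\<bar> \<le> 1"
    using assms unfolding necklace_def by blast
  have "\<exists>x. x \<in> H (2 * n)" for n
    using H[of "2 * n" "2 * n"] by auto
  then obtain x where x: "\<And>n. x n \<in> H (2 * n)"
    by metis
  have "inj x"
  proof (rule injI)
    fix m n assume "x m = x n"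
    then have "\<bar>int (2 * m) - int (2 * n)\<bar> \<le> 1"
      using x[of m] x[of n] H[of "2 * m" "2 * n"] by auto
    then show "m = n"
      by presburger
  qed
  moreover have "range x \<subseteq> N"
    using x N by blast
  ultimately show False
    using fin by (meson finite_subset finite_imageD infinite_UNIV_nat)
qed

text \<open>Each point lies only in beads of neighbouring indices, so a finite set meets finitely
  many beads and is avoided by dropping an initial segment.\<close>

lemma necklace_avoiding:
  assumes "necklace \<C> N" "finite X"
  obtains N' where "necklace \<C> N'" "N' \<subseteq> N" "N' \<inter> X = {}" "finite (N - N')"
proof -
  obtain H :: "nat \<Rightarrow> 'a set" where fin: "\<And>n. finite (H n)" and C: "\<And>n. H n \<in> \<C>"
    and N: "N = (\<Union>n. H n)"
    and H: "\<And>i j. H i \<inter> H j \<noteq> {} \<longleftrightarrow> \<bar>int i - int j\<bar> \<le> 1"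
    using assms(1) unfolding necklace_def by metis
  have "finite {n. x \<in> H n}" for x
  proof (cases "\<exists>m. x \<in> H m")
    case True
    then obtain m where m: "x \<in> H m" ..
    have "{n. x \<in> H n} \<subseteq> {..Suc m}"
    proof
      fix n assume "n \<in> {n. x \<in> H n}"
      then have "\<bar>int n - int m\<bar> \<le> 1"
        using H[of n m] m by auto
      then show "n \<in> {..Suc m}"
        by auto
    qed
    then show ?thesis
      by (rule finite_subset) simp
  qed auto
  then have "finite (\<Union>x\<in>X. {n. x \<in> H n})"
    using assms(2) by blast
  then obtain k where k: "\<And>n x. x \<in> X \<Longrightarrow> x \<in> H n \<Longrightarrow> n < k"
    by (auto simp: finite_nat_set_iff_bounded)
  let ?N = "\<Union>n. H (n + k)"
  have "necklace \<C> ?N"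
    unfolding necklace_def
  proof (intro conjI exI[of _ "\<lambda>n. H (n + k)"] allI)
    show "?N \<in> \<C>"
    proof (rule connected_chain[of "\<lambda>n. H (n + k)"])
      show "H (n + k) \<inter> H (Suc n + k) \<noteq> {}" for n
        unfolding H by simp
    qed (rule C)
    show "H (i + k) \<inter> H (j + k) \<noteq> {} \<longleftrightarrow> \<bar>int i - int j\<bar> \<le> 1" for i j
      unfolding H by simp
  qed (use fin C in auto)
  moreover have "?N \<subseteq> N"
    using N by blast
  moreover have "?N \<inter> X = {}"
    using k by fastforce
  moreover have "N - ?N \<subseteq> (\<Union>n<k. H n)"
  proof
    fix x assume x: "x \<in> N - ?N"
    then obtain n where n: "x \<in> H n" using N by blast
    have "n < k"
    proof (rule ccontr)
      assume "\<not> n < k"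
      then have "x \<in> H ((n - k) + k)"
        using n by simp
      then show False
        using x by blast
    qed
    then show "x \<in> (\<Union>n<k. H n)"
      using n by blast
  qed
  then have "finite (N - ?N)"
    by (rule finite_subset) (use fin in simp)
  ultimately show thesis
    using that by blast
qed

text \<open>The exact intersection pattern of a necklace is awkward to construct. It is enough that
  consecutive sets meet and that each point is eventually left: long blocks of consecutive sets then
  serve as beads.\<close>

lemma necklace_chain:
  assumes fin: "\<And>n. finite (J n)" and C: "\<And>n. J n \<in> \<C>"
    and link: "\<And>n. J n \<inter> J (Suc n) \<noteq> {}"
    and locfin: "\<And>x. x \<in> (\<Union>n. J n) \<Longrightarrow> \<exists>m. \<forall>i\<ge>m. x \<notin> J i"
  shows "necklace \<C> (\<Union>n::nat. J n)"
proof -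
  have "\<exists>m>k. \<forall>i\<ge>m. \<forall>j<k. J i \<inter> J j = {}" for k
  proof -
    obtain f where f: "\<And>x i. x \<in> (\<Union>n. J n) \<Longrightarrow> f x \<le> i \<Longrightarrow> x \<notin> J i"
      using locfin by metis
    have "finite (f ` (\<Union>j<k. J j))"
      using fin by simp
    then obtain b where b: "\<And>x. x \<in> (\<Union>j<k. J j) \<Longrightarrow> f x \<le> b"
      by (meson finite_nat_set_iff_bounded_le imageI)
    have "x \<notin> J i" if "i \<ge> Suc (b + k)" "j < k" "x \<in> J j" for i j x
    proof (rule f)
      show "x \<in> (\<Union>n. J n)"
        using that by blast
      have "x \<in> (\<Union>j<k. J j)"
        using that by blast
      then have "f x \<le> b"
        by (rule b)
      then show "f x \<le> i"
        using that by simp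
    qed
    then have "\<forall>i\<ge>Suc (b + k). \<forall>j<k. J i \<inter> J j = {}"
      by blast
    then show ?thesis
      by (intro exI[of _ "Suc (b + k)"]) simp
  qed
  \<comment> \<open>From index \<open>g k\<close> on, no set meets any of the first \<open>k\<close>
    sets. Iterating \<open>g\<close> yields the indices \<open>M\<close> at which the blocks
    start.\<close>
  then obtain g where g: "\<And>k. g k > k" "\<And>k i j. g k \<le> i \<Longrightarrow> j < k \<Longrightarrow> J i \<inter> J j = {}"
    by metis
  define M where "M = rec_nat 0 (\<lambda>_. g)"
  have M: "M 0 = 0" "\<And>n. M (Suc n) = g (M n)"
    by (simp_all add: M_def)
  have mono: "strict_mono M"
    using g(1) by (simp add: strict_mono_Suc_iff M)
  \<comment> \<open>Neighbouring blocks share no index but still meet, through the last set of one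
    and the first set of the next. Block \<open>k + 2\<close> starts at \<open>g (M (Suc k))\<close>
    and so misses block \<open>k\<close>.\<close>
  define H where "H k = (\<Union>i\<in>{M k..M (Suc k) - 1}. J i)" for k
  have less: "M k \<le> M (Suc k) - 1" for k
    using g(1)[of "M k"] by (simp add: M)
  have H_conn: "H k \<in> \<C>" for k
    unfolding H_def by (rule connected_atLeastAtMost_chain[of J, OF C link less])
  have "i < M (Suc i)" for i
    by (metis mono strict_mono_imp_increasing Suc_le_lessD)
  have block: "\<exists>k. i \<in> {M k..M (Suc k) - 1}" for i
  proof -
    define k where "k = (LEAST k. i < M (Suc k))"
    have "i < M (Suc k)"
      unfolding k_def by (rule LeastI[of _ i]) fact
    moreover have "M k \<le> i"
    proof (cases k)
      case (Suc k')
      then have "\<not> i < M (Suc k')"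
        using not_less_Least[of k' "\<lambda>k. i < M (Suc k)"] by (simp add: k_def)
      then show ?thesis using Suc by simp
    qed (simp add: M)
    ultimately show ?thesis
      by (intro exI[of _ k]) auto
  qed
  have UN: "(\<Union>n. J n) = (\<Union>k. H k)"
    unfolding H_def using block by blast
  have H_ne: "H k \<noteq> {}" for k
    unfolding H_def using link less[of k] by fastforce
  have adj: "H k \<inter> H (Suc k) \<noteq> {}" for k
  proof -
    have "J (M (Suc k) - 1) \<subseteq> H k" "J (M (Suc k)) \<subseteq> H (Suc k)"
      unfolding H_def using less[of k] less[of "Suc k"] by auto
    moreover have "Suc (M (Suc k) - 1) = M (Suc k)"
      using g(1)[of "M k"] by (simp add: M)
    ultimately show ?thesis
      using link[of "M (Suc k) - 1"] by auto
  qed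
  have disj: "H k \<inter> H l = {}" if "k + 2 \<le> l" for k l
  proof -
    have "J i \<inter> J j = {}" if "i \<in> {M l..M (Suc l) - 1}" "j \<in> {M k..M (Suc k) - 1}" for i j
    proof (rule g(2))
      have "M (Suc (Suc k)) \<le> M l"
        using \<open>k + 2 \<le> l\<close> mono by (simp add: strict_mono_less_eq)
      then show "g (M (Suc k)) \<le> i"
        using that by (simp add: M)
      show "j < M (Suc k)"
        using that g(1)[of "M k"] by (auto simp: M)
    qed
    then show ?thesis
      unfolding H_def by blast
  qed
  have "H i \<inter> H j \<noteq> {} \<longleftrightarrow> \<bar>int i - int j\<bar> \<le> 1" for i j
  proof -
    consider "i = j" | "j = Suc i" | "i = Suc j" | "i + 2 \<le> j" | "j + 2 \<le> i"
      by linarith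
    then show ?thesis
      by cases (use H_ne adj[of i] adj[of j] disj[of i j] disj[of j i] in auto)
  qed
  moreover have "finite (H k)" for k
    using fin by (simp add: H_def)
  ultimately show ?thesis
    unfolding necklace_def UN using H_conn connected_chain[of H, OF H_conn adj]
    by (intro conjI exI[of _ H]) auto
qed

end

section \<open>Ends and dispersed sets\<close>

context connectoid_space
begin

lemma cofinite_parts_meet:
  assumes "necklace \<C> N" "finite (N - C)" "finite (N - C')"
  shows "N \<inter> C \<inter> C' \<noteq> {}"
proof
  assume "N \<inter> C \<inter> C' = {}"
  then have "N \<subseteq> (N - C) \<union> (N - C')"
    by blast
  then show False
    using assms infinite_necklace by (meson finite_Un finite_subset)
qed

text \<open>The free set \<open>A\<close> covers two uses: \<open>N - X\<close> gives the tail of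
  the necklace, and \<open>S - X\<close> gives the component that belongs to its end.\<close>

lemma tail_component:
  assumes "necklace \<C> N" "finite X" "N - X \<subseteq> A"
  obtains K where "K \<in> comps A" "finite (N - K)"
proof -
  obtain N' where N': "necklace \<C> N'" "N' \<subseteq> N" "N' \<inter> X = {}" "finite (N - N')"
    using necklace_avoiding[OF assms(1,2)] .
  have "N' \<noteq> {}"
    using infinite_necklace[OF N'(1)] by auto
  moreover have "N' \<subseteq> A"
    using N' assms(3) by blast
  ultimately obtain K where K: "K \<in> comps A" "N' \<subseteq> K"
    using component_of_connected necklace_connected[OF N'(1)] by metis
  then have "N - K \<subseteq> N - N'"
    by blast
  then show thesis
    using that K(1) N'(4) finite_subset by metis
qed

lemma necklace_tail_component:
  assumes "necklace \<C> N" "finite X"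
  shows "necklace_tail \<C> X N \<in> comps (N - X)" "finite (N - necklace_tail \<C> X N)"
proof -
  have "\<exists>!K. K \<in> comps (N - X) \<and> finite (N - K)"
  proof (rule ex_ex1I)
    show "\<exists>K. K \<in> comps (N - X) \<and> finite (N - K)"
      using tail_component[OF assms, of "N - X"] by blast
    fix K K' assume "K \<in> comps (N - X) \<and> finite (N - K)" "K' \<in> comps (N - X) \<and> finite (N - K')"
    then show "K = K'"
      using component_eqI cofinite_parts_meet[OF assms(1), of K K'] by blast
  qed
  from theI'[OF this] show "necklace_tail \<C> X N \<in> comps (N - X)" "finite (N - necklace_tail \<C> X N)"
    by (auto simp: necklace_tail_def)
qed

text \<open>This removes the definite description: from here on, ends are handled through sets that
  contain almost all of a necklace.\<close>

lemma necklace_tail_subset_iff: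
  assumes N: "necklace \<C> N" and X: "finite X" and K: "K \<in> comps (S - X)"
  shows "necklace_tail \<C> X N \<subseteq> K \<longleftrightarrow> finite (N - K)"
proof
  note tail = necklace_tail_component[OF N X]
  show "finite (N - K)" if "necklace_tail \<C> X N \<subseteq> K"
    by (rule finite_subset[OF _ tail(2)]) (use that in blast)
  show "necklace_tail \<C> X N \<subseteq> K" if "finite (N - K)"
  proof (rule component_absorbs[OF K])
    show "necklace_tail \<C> X N \<in> \<C>"
      by (rule component_connected[OF tail(1)])
    show "necklace_tail \<C> X N \<subseteq> S - X"
      using component_subset[OF tail(1)] necklace_subset[OF N] by auto
    show "necklace_tail \<C> X N \<inter> K \<noteq> {}"
      using cofinite_parts_meet[OF N tail(2) that] by auto
  qed
qed

lemma necklace_equiv_iff: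
  "(N, N') \<in> necklace_equiv S \<C> \<longleftrightarrow> necklace \<C> N \<and> necklace \<C> N' \<and>
     (\<forall>X. finite X \<and> X \<subseteq> S \<longrightarrow> (\<exists>K\<in>comps (S - X). finite (N - K) \<and> finite (N' - K)))"
proof -
  have "(\<exists>K\<in>comps (S - X). necklace_tail \<C> X N \<subseteq> K \<and> necklace_tail \<C> X N' \<subseteq> K) \<longleftrightarrow>
        (\<exists>K\<in>comps (S - X). finite (N - K) \<and> finite (N' - K))"
    if "necklace \<C> N" "necklace \<C> N'" "finite X" for X
    by (rule bex_cong) (simp_all add: necklace_tail_subset_iff that)
  then show ?thesis
    by (simp add: necklace_equiv_def cong: conj_cong imp_cong)
qed

lemma necklace_equiv_subset:
  assumes N: "necklace \<C> N" and N': "necklace \<C> N'" "N' \<subseteq> N"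
  shows "(N, N') \<in> necklace_equiv S \<C>"
  unfolding necklace_equiv_iff
proof (intro conjI allI impI N N')
  fix X assume X: "finite X \<and> X \<subseteq> S"
  obtain K where K: "K \<in> comps (S - X)" "finite (N - K)"
    using tail_component[OF N, of X "S - X"] X necklace_subset[OF N] by blast
  moreover have "finite (N' - K)"
    by (rule finite_subset[OF _ K(2)]) (use N' in blast)
  ultimately show "\<exists>K\<in>comps (S - X). finite (N - K) \<and> finite (N' - K)"
    by blast
qed

lemma ctd_endsE:
  assumes "\<omega> \<in> ctd_ends S \<C>"
  obtains N where "necklace \<C> N" "\<omega> = necklace_equiv S \<C> `` {N}"
  using assms by (auto simp: ctd_ends_def elim: quotientE)

text \<open>\<open>end_component\<close> asks for a member of the class that lies entirely in the
  component. As \<open>N\<close> may do so only up to finitely many points, a subnecklace avoiding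
  \<open>X\<close> takes its place.\<close>

lemma end_component_eq:
  assumes N: "necklace \<C> N" and X: "finite X" "X \<subseteq> S"
    and K: "K \<in> comps (S - X)" "finite (N - K)"
  shows "end_component S \<C> X (necklace_equiv S \<C> `` {N}) = K"
  unfolding end_component_def
proof (rule the_equality)
  obtain N' where N': "necklace \<C> N'" "N' \<subseteq> N" "N' \<inter> X = {}" "finite (N - N')"
    using necklace_avoiding[OF N X(1)] .
  have "N' \<subseteq> K"
  proof (rule component_absorbs[OF K(1) necklace_connected[OF N'(1)]])
    show "N' \<subseteq> S - X"
      using N' necklace_subset by blast
    show "N' \<inter> K \<noteq> {}"
      using cofinite_parts_meet[OF N N'(4) K(2)] by blast
  qed
  then show "K \<in> comps (S - X) \<and> (\<exists>N'\<in>necklace_equiv S \<C> `` {N}. N' \<subseteq> K)"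
    using K(1) necklace_equiv_subset[OF N N'(1,2)] by blast
next
  fix K' assume K': "K' \<in> comps (S - X) \<and> (\<exists>N'\<in>necklace_equiv S \<C> `` {N}. N' \<subseteq> K')"
  then obtain N' where N': "(N, N') \<in> necklace_equiv S \<C>" "N' \<subseteq> K'"
    by blast
  then obtain L where L: "L \<in> comps (S - X)" "finite (N - L)" "finite (N' - L)" "necklace \<C> N'"
    using X by (auto simp: necklace_equiv_iff)
  have "finite (N' - K')"
    using N'(2) by (simp add: Diff_eq_empty_iff[THEN iffD2])
  then have "N' \<inter> L \<inter> K' \<noteq> {}"
    using cofinite_parts_meet[OF L(4,3), of K'] by simp
  then have "K' = L"
    using component_eqI[of K' "S - X" L] K' L(1) by blast
  moreover have "K = L"
    using component_eqI[OF K(1) L(1)] cofinite_parts_meet[OF N K(2) L(2)] by blast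
  ultimately show "K' = K"
    by simp
qed

lemma necklace_class_in_ends:
  assumes "necklace \<C> N"
  shows "necklace_equiv S \<C> `` {N} \<in> ctd_ends S \<C>"
  using assms by (auto simp: ctd_ends_def intro: quotientI)

lemma end_component_empty:
  assumes "S \<in> \<C>" "\<omega> \<in> ctd_ends S \<C>"
  shows "end_component S \<C> {} \<omega> = S"
proof -
  obtain N where N: "necklace \<C> N" "\<omega> = necklace_equiv S \<C> `` {N}"
    using ctd_endsE[OF assms(2)] .
  have "finite (N - S)"
    using necklace_subset[OF N(1)] by (simp add: Diff_eq_empty_iff[THEN iffD2])
  moreover have "S \<in> comps (S - {})"
    using assms(1) by (auto simp: ctd_components_def)
  ultimately show ?thesis
    using end_component_eq[OF N(1), of "{}" S] N(2) by simp
qed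


text \<open>Separation is tested on all connected sets that contain almost all of \<open>N\<close>,
  not on the tail or on a component of \<open>S - X\<close>. No ground set occurs in this form,
  which eases the comparison with subconnectoids.\<close>

definition dispersed :: "'a set \<Rightarrow> bool" where
  "dispersed A \<longleftrightarrow> (\<forall>N. necklace \<C> N \<longrightarrow>
     (\<exists>X. finite X \<and> (\<forall>C\<in>\<C>. C \<inter> X = {} \<and> finite (N - C) \<longrightarrow> C \<inter> A = {})))"

definition sigma_dispersed :: "'a set \<Rightarrow> bool" where
  "sigma_dispersed A \<longleftrightarrow> (\<exists>f :: nat \<Rightarrow> 'a set. (\<forall>n. dispersed (f n)) \<and> A \<subseteq> (\<Union>n. f n))"

lemma dispersedI:
  assumes "\<And>N. necklace \<C> N \<Longrightarrow>
    \<exists>X. finite X \<and> (\<forall>C\<in>\<C>. C \<inter> X = {} \<and> finite (N - C) \<longrightarrow> C \<inter> A = {})"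
  shows "dispersed A"
  using assms by (simp add: dispersed_def)

lemma dispersedE:
  assumes "dispersed A" "necklace \<C> N"
  obtains X where "finite X"
    "\<And>C. C \<in> \<C> \<Longrightarrow> C \<inter> X = {} \<Longrightarrow> finite (N - C) \<Longrightarrow> C \<inter> A = {}"
  using assms by (auto simp: dispersed_def)

lemma dispersed_subset:
  assumes "dispersed A" "B \<subseteq> A"
  shows "dispersed B"
proof (rule dispersedI)
  fix N assume "necklace \<C> N"
  then obtain X where "finite X" "\<And>C. C \<in> \<C> \<Longrightarrow> C \<inter> X = {} \<Longrightarrow> finite (N - C) \<Longrightarrow> C \<inter> A = {}"
    using dispersedE[OF assms(1)] by metis
  then show "\<exists>X. finite X \<and> (\<forall>C\<in>\<C>. C \<inter> X = {} \<and> finite (N - C) \<longrightarrow> C \<inter> B = {})"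
    using assms(2) by (intro exI[of _ X]) blast
qed

lemma dispersed_finite:
  assumes "finite A"
  shows "dispersed A"
  by (rule dispersedI) (use assms in blast)

lemma dispersed_Un:
  assumes "dispersed A" "dispersed B"
  shows "dispersed (A \<union> B)"
proof (rule dispersedI)
  fix N assume N: "necklace \<C> N"
  obtain X where X: "finite X" "\<And>C. C \<in> \<C> \<Longrightarrow> C \<inter> X = {} \<Longrightarrow> finite (N - C) \<Longrightarrow> C \<inter> A = {}"
    using dispersedE[OF assms(1) N] by metis
  obtain Y where Y: "finite Y" "\<And>C. C \<in> \<C> \<Longrightarrow> C \<inter> Y = {} \<Longrightarrow> finite (N - C) \<Longrightarrow> C \<inter> B = {}"
    using dispersedE[OF assms(2) N] by metis
  have "C \<inter> (A \<union> B) = {}" if "C \<in> \<C>" "C \<inter> (X \<union> Y) = {}" "finite (N - C)" for C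
    using X(2)[of C] Y(2)[of C] that by blast
  then show "\<exists>X. finite X \<and> (\<forall>C\<in>\<C>. C \<inter> X = {} \<and> finite (N - C) \<longrightarrow> C \<inter> (A \<union> B) = {})"
    using X(1) Y(1) by (intro exI[of _ "X \<union> Y"]) auto
qed

lemma sigma_dispersed_subset: "sigma_dispersed A \<Longrightarrow> B \<subseteq> A \<Longrightarrow> sigma_dispersed B"
  unfolding sigma_dispersed_def by (meson subset_trans)

lemma sigma_dispersed_UN:
  assumes "\<And>i::nat. sigma_dispersed (A i)"
  shows "sigma_dispersed (\<Union>i. A i)"
proof -
  obtain f where f: "\<And>i n. dispersed (f i n)" "\<And>i. A i \<subseteq> (\<Union>n::nat. f i n)"
    using assms unfolding sigma_dispersed_def by metis
  let ?g = "\<lambda>k. f (fst (prod_decode k)) (snd (prod_decode k))"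
  have "A i \<subseteq> (\<Union>k. ?g k)" for i
  proof
    fix x assume "x \<in> A i"
    then obtain n where "x \<in> f i n"
      using f(2) by blast
    then have "x \<in> ?g (prod_encode (i, n))"
      by simp
    then show "x \<in> (\<Union>k. ?g k)"
      by blast
  qed
  then show ?thesis
    using f(1) by (auto simp: sigma_dispersed_def intro!: exI[of _ ?g])
qed

text \<open>With an increasing cover, lying in a set of index at most \<open>k\<close> becomes
  membership in the single dispersed set \<open>f k\<close>.\<close>

lemma sigma_dispersed_mono_cover:
  assumes "sigma_dispersed A"
  obtains f where "\<And>n. dispersed (f n)" "mono f" "A \<subseteq> (\<Union>n::nat. f n)"
proof -
  obtain f where f: "\<And>n. dispersed (f n)" "A \<subseteq> (\<Union>n::nat. f n)"
    using assms unfolding sigma_dispersed_def by metis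
  have "dispersed (\<Union>i\<le>n. f i)" for n
    by (induction n) (simp_all add: f(1) atMost_Suc dispersed_Un)
  moreover have "mono (\<lambda>n. \<Union>i\<le>n. f i)"
    by (rule monoI) force
  moreover have "A \<subseteq> (\<Union>n. \<Union>i\<le>n. f i)"
    using f(2) by blast
  ultimately show thesis
    by (rule that)
qed

text \<open>The \<open>n\<close>-th pieces of all components, however many, unite to one dispersed
  set. A given necklace has almost all of its points in at most one component, so only the piece of
  that component has to be separated from it; \<open>X\<close> and \<open>Y\<close> cut off all the
  others.\<close>

lemma sigma_dispersed_components:
  assumes D: "D \<in> comps (S - X)" and fin: "finite X" "finite Y"
    and K: "\<And>K. K \<in> comps (D - Y) \<Longrightarrow> K \<noteq> {} \<Longrightarrow> sigma_dispersed (U \<inter> K)"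
  shows "sigma_dispersed (U \<inter> D)"
proof -
  let ?\<K> = "comps (D - Y) - {{}}"
  have "\<exists>f. (\<forall>n. dispersed (f n) \<and> f n \<subseteq> K) \<and> U \<inter> K \<subseteq> (\<Union>n::nat. f n)" if "K \<in> ?\<K>" for K
  proof -
    have "sigma_dispersed (U \<inter> K)"
      using K that by blast
    then obtain f where f: "\<And>n. dispersed (f n)" "U \<inter> K \<subseteq> (\<Union>n::nat. f n)"
      unfolding sigma_dispersed_def by metis
    \<comment> \<open>Cutting the pieces down to \<open>K\<close> keeps those of different
      components apart.\<close>
    show ?thesis
      by (rule exI[of _ "\<lambda>n. f n \<inter> K"]) (use f in \<open>auto intro: dispersed_subset\<close>)
  qed
  then obtain f where f: "\<And>K n. K \<in> ?\<K> \<Longrightarrow> dispersed (f K n)" "\<And>K n. K \<in> ?\<K> \<Longrightarrow> f K n \<subseteq> K"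
    "\<And>K. K \<in> ?\<K> \<Longrightarrow> U \<inter> K \<subseteq> (\<Union>n::nat. f K n)"
    by metis
  define g where "g n = Y \<union> (\<Union>K\<in>?\<K>. f K n)" for n
  have comp: "K \<in> comps (S - (X \<union> Y))" if "K \<in> ?\<K>" for K
    using component_Diff[OF D] that by blast
  have "dispersed (g n)" for n
  proof (rule dispersedI)
    fix N assume N: "necklace \<C> N"
    show "\<exists>X. finite X \<and> (\<forall>C\<in>\<C>. C \<inter> X = {} \<and> finite (N - C) \<longrightarrow> C \<inter> g n = {})"
    proof (cases "\<exists>K\<in>?\<K>. finite (N - K)")
      case True
      then obtain K where K: "K \<in> ?\<K>" "finite (N - K)"
        by blast
      obtain Z where Z: "finite Z"
        "\<And>C. C \<in> \<C> \<Longrightarrow> C \<inter> Z = {} \<Longrightarrow> finite (N - C) \<Longrightarrow> C \<inter> f K n = {}"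
        using dispersedE[OF f(1)[OF K(1)] N] by metis
      have "C \<inter> g n = {}" if C: "C \<in> \<C>" "C \<inter> (X \<union> Y \<union> Z) = {}" "finite (N - C)" for C
      proof -
        have "C \<subseteq> K"
        proof (rule component_absorbs[OF comp[OF K(1)] C(1)])
          show "C \<subseteq> S - (X \<union> Y)"
            using C connected_subset by blast
          show "C \<inter> K \<noteq> {}"
            using cofinite_parts_meet[OF N C(3) K(2)] by blast
        qed
        moreover have "K \<inter> f K' n = {}" if "K' \<in> ?\<K>" "K' \<noteq> K" for K'
          using component_eqI[of K "D - Y" K'] f(2)[of K' n] that K(1) by blast
        moreover have "C \<inter> f K n = {}"
          using Z(2) C by blast
        ultimately show ?thesis
          using C(2) unfolding g_def by blast
      qed
      then show ?thesis
        using fin Z(1) by (intro exI[of _ "X \<union> Y \<union> Z"]) auto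
    next
      \<comment> \<open>No component contains almost all of \<open>N\<close>, so a connected set
        that does, and that avoids \<open>X \<union> Y\<close>, can meet none of them.\<close>
      case False
      have "C \<inter> g n = {}" if C: "C \<in> \<C>" "C \<inter> (X \<union> Y) = {}" "finite (N - C)" for C
      proof -
        have "C \<inter> K = {}" if "K \<in> ?\<K>" for K
        proof (rule ccontr)
          assume "C \<inter> K \<noteq> {}"
          then have "C \<subseteq> K"
            using component_absorbs[OF comp[OF that] C(1)] C connected_subset by blast
          then have "N - K \<subseteq> N - C"
            by blast
          then show False
            using False that C(3) finite_subset by blast
        qed
        then show ?thesis
          using C(2) f(2) unfolding g_def by blast
      qed
      then show ?thesis
        using fin by (intro exI[of _ "X \<union> Y"]) auto
    qed
  qed
  moreover have "U \<inter> D \<subseteq> (\<Union>n. g n)"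
  proof
    fix u assume u: "u \<in> U \<inter> D"
    show "u \<in> (\<Union>n. g n)"
    proof (cases "u \<in> Y")
      case False
      have "D - Y \<subseteq> S"
        using D component_subset by blast
      then obtain K where "K \<in> comps (D - Y)" "u \<in> K"
        using component_of_point[of "D - Y" u] u False by blast
      then show ?thesis
        using f(3)[of K] u unfolding g_def by blast
    qed (auto simp: g_def)
  qed
  ultimately show ?thesis
    unfolding sigma_dispersed_def by blast
qed

end

section \<open>Paths in rooted trees\<close>

lemma graph_path_iff_successively:
  "graph_path V E p \<longleftrightarrow> p \<noteq> [] \<and> set p \<subseteq> V \<and> distinct p \<and> successively (\<lambda>x y. {x, y} \<in> E) p"
  by (auto simp: graph_path_def successively_conv_nth)

lemma graph_path_Cons_tl:
  "graph_path V E (a # p) \<Longrightarrow> p \<noteq> [] \<Longrightarrow> graph_path V E p"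
  by (auto simp: graph_path_iff_successively successively_Cons)

lemma graph_path_append1:
  "graph_path V E (p @ q) \<Longrightarrow> p \<noteq> [] \<Longrightarrow> graph_path V E p"
  by (auto simp: graph_path_iff_successively successively_append_iff)

lemma successively_rev_edges:
  "successively (\<lambda>x y. {x, y} \<in> E) (rev p) \<longleftrightarrow> successively (\<lambda>x y. {x, y} \<in> E) p"
  by (simp add: insert_commute)

text \<open>The induction strips common initial vertices. Where the paths part, at \<open>a\<close>,
  a cycle runs along \<open>p\<close> up to its first vertex \<open>x\<close> on \<open>q'\<close>
  and returns along \<open>q'\<close>.\<close>

lemma distinct_paths_imp_cycle:
  assumes "graph_path V E p" "graph_path V E q" "hd p = hd q" "last p = last q" "p \<noteq> q"
  shows "\<exists>c. graph_cycle V E c"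
  using assms
proof (induction p arbitrary: q)
  case Nil
  then show ?case by (simp add: graph_path_def)
next
  case (Cons a p q)
  obtain q' where q: "q = a # q'"
    using Cons.prems by (cases q) (auto simp: graph_path_def)
  have dist: "distinct (a # p)" "distinct (a # q')"
    using Cons.prems q by (auto simp: graph_path_def)
  have ne: "p \<noteq> []" "q' \<noteq> []"
    using Cons.prems dist q last_in_set[of p] last_in_set[of q'] by (auto split: if_splits)
  have paths: "graph_path V E p" "graph_path V E q'"
    using Cons.prems(1,2) graph_path_Cons_tl ne q by metis+
  have last: "last p = last q'"
    using Cons.prems ne q by simp
  show ?case
  proof (cases "hd p = hd q'")
    case True
    then show ?thesis
      using Cons.IH[OF paths True last] Cons.prems(5) q by simp
  next
    case False
    have "\<exists>x\<in>set p. x \<in> set q'"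
      using last ne last_in_set by metis
    then obtain p1 x p2 where p: "p = p1 @ x # p2" "x \<in> set q'" "\<forall>y\<in>set p1. y \<notin> set q'"
      using split_list_first_propE[of p "\<lambda>x. x \<in> set q'"] by metis
    obtain q1 q2 where q': "q' = q1 @ x # q2"
      using p(2) split_list by metis
    let ?c = "a # p1 @ x # rev q1"
    \<comment> \<open>Since the paths part at \<open>a\<close>, the vertex \<open>x\<close> is not
      next on both of them; this supplies the third vertex of the cycle.\<close>
    have "p1 \<noteq> [] \<or> q1 \<noteq> []"
      using False p(1) q' by auto
    then have "3 \<le> length ?c"
      by (cases p1; cases q1) auto
    moreover have "graph_path V E ?c"
      unfolding graph_path_iff_successively
    proof (intro conjI)
      show "?c \<noteq> []" "set ?c \<subseteq> V" "distinct ?c"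
        using Cons.prems(1,2) p q q' dist by (auto simp: graph_path_def)
      have "successively (\<lambda>x y. {x, y} \<in> E) (a # p1 @ [x])"
        using Cons.prems(1) p(1) unfolding graph_path_iff_successively
        by (auto simp: successively_Cons successively_append_iff hd_append split: if_splits)
      moreover have "successively (\<lambda>x y. {x, y} \<in> E) (rev (q1 @ [x]))"
        using paths(2) q' unfolding successively_rev_edges graph_path_iff_successively
        by (auto simp: successively_Cons successively_append_iff)
      ultimately have "successively (\<lambda>x y. {x, y} \<in> E) ((a # p1 @ [x]) @ rev q1)"
        by (subst successively_append_iff) (auto simp: successively_Cons)
      then show "successively (\<lambda>x y. {x, y} \<in> E) ?c"
        by simp
    qed
    moreover have "{last ?c, hd ?c} \<in> E"
    proof -
      have "last ?c = hd (q1 @ [x])"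
        by (cases q1) auto
      also have "\<dots> = hd q'"
        using q' by (cases q1) auto
      finally show ?thesis
        using Cons.prems(2) q ne unfolding graph_path_iff_successively
        by (auto simp: successively_Cons insert_commute)
    qed
    ultimately show ?thesis
      unfolding graph_cycle_def by blast
  qed
qed

text \<open>It turns the tree-order into list operations: the strict predecessors of
  \<open>v\<close> are the entries of \<open>butlast\<close>, and the length is the height plus
  one.\<close>

definition root_path :: "'a set \<Rightarrow> 'a set set \<Rightarrow> 'a \<Rightarrow> 'a \<Rightarrow> 'a list" where
  "root_path V E r v = (THE p. graph_path V E p \<and> hd p = r \<and> last p = v)"

context
  fixes V :: "'a set" and E r
  assumes tree: "rooted_tree V E r"
begin

lemma root_path_unique:
  assumes "graph_path V E p" "hd p = r" "last p = v"
  shows "root_path V E r v = p"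
  unfolding root_path_def
  by (rule the_equality)
    (use assms tree distinct_paths_imp_cycle in \<open>unfold rooted_tree_def; blast\<close>)+

lemma root_path:
  assumes "v \<in> V"
  shows "graph_path V E (root_path V E r v)" "hd (root_path V E r v) = r"
    "last (root_path V E r v) = v"
proof -
  obtain p where "graph_path V E p" "hd p = r" "last p = v"
    using tree assms unfolding rooted_tree_def by metis
  then show "graph_path V E (root_path V E r v)" "hd (root_path V E r v) = r"
    "last (root_path V E r v) = v"
    using root_path_unique by simp_all
qed

lemma tree_le_iff:
  assumes "v \<in> V"
  shows "tree_le V E r u v \<longleftrightarrow> u \<in> set (root_path V E r v)"
  using root_path[OF assms] root_path_unique unfolding tree_le_def by metis

lemma tree_le_in_V: "tree_le V E r u v \<Longrightarrow> u \<in> V \<and> v \<in> V"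
  unfolding tree_le_def graph_path_def by (metis last_in_set subsetD)

lemma root_path_prefix:
  assumes "v \<in> V" "root_path V E r v = p @ u # q"
  shows "root_path V E r u = p @ [u]"
proof (rule root_path_unique)
  have *: "graph_path V E (p @ u # q)" "hd (p @ u # q) = r"
    using root_path[OF assms(1)] assms(2) by simp_all
  then show "graph_path V E (p @ [u])"
    using graph_path_append1[of V E "p @ [u]" q] by simp
  show "hd (p @ [u]) = r"
    using * by (cases p) auto
qed simp

lemma root_path_distinct: "v \<in> V \<Longrightarrow> distinct (root_path V E r v)"
  using root_path(1) by (simp add: graph_path_def)

lemma root_path_snoc:
  assumes "v \<in> V"
  shows "root_path V E r v = butlast (root_path V E r v) @ [v]"
  using root_path[OF assms] unfolding graph_path_def by (metis append_butlast_last_id)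

lemma root_path_root: "root_path V E r r = [r]"
  by (rule root_path_unique) (use tree in \<open>auto simp: rooted_tree_def graph_path_def\<close>)

lemma strictly_below_iff:
  assumes "v \<in> V"
  shows "tree_le V E r w v \<and> w \<noteq> v \<longleftrightarrow> w \<in> set (butlast (root_path V E r v))"
proof -
  have "w \<in> set (root_path V E r v) \<longleftrightarrow> w \<in> set (butlast (root_path V E r v)) \<or> w = v"
    by (subst root_path_snoc[OF assms]) auto
  moreover have "v \<notin> set (butlast (root_path V E r v))"
    using root_path_distinct[OF assms] by (subst (asm) root_path_snoc[OF assms]) simp
  ultimately show ?thesis
    using tree_le_iff[OF assms] by blast
qed

lemma tree_le_split:
  assumes "tree_le V E r u v"
  obtains q where "root_path V E r v = root_path V E r u @ q"
proof -
  have v: "v \<in> V"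
    using tree_le_in_V assms by blast
  then have "u \<in> set (root_path V E r v)"
    using assms tree_le_iff by simp
  then obtain p q where "root_path V E r v = p @ u # q"
    by (meson split_list)
  then show thesis
    using root_path_prefix[OF v] that[of q] by simp
qed

end

section \<open>Levels of weak normal trees\<close>

context connectoid_space
begin

context
  fixes V E r
  assumes T: "weak_normal_tree S \<C> V E r"
begin

private lemma tree: "rooted_tree V E r"
  using T by (simp add: weak_normal_tree_def)

private lemma separated:
  assumes "C \<in> \<C>" "u \<in> C" "v \<in> C" "u \<in> V" "v \<in> V" "\<not> tree_le V E r u v" "\<not> tree_le V E r v u"
  shows "\<exists>w\<in>C. tree_le V E r w u \<and> tree_le V E r w v"
  using T assms by (simp add: weak_normal_tree_def)

private lemma linked:
  assumes "tree_le V E r u v"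
  shows "\<exists>C\<in>\<C>. u \<in> C \<and> v \<in> C \<and> \<not> (\<exists>w\<in>C. tree_le V E r w u \<and> w \<noteq> u)"
  using T assms tree_le_in_V[OF tree assms] by (simp add: weak_normal_tree_def)

text \<open>Otherwise \<open>C\<close> would contain a vertex strictly below \<open>t\<close>:
  either \<open>s\<close> itself, or the common lower bound that normality demands for incomparable
  \<open>t\<close> and \<open>s\<close>.\<close>

lemma connected_above:
  assumes C: "C \<in> \<C>" "C \<inter> set (butlast (root_path V E r t)) = {}" and "t \<in> C" "s \<in> C" "t \<in> V" "s \<in> V"
  shows "tree_le V E r t s"
proof (rule ccontr)
  assume not: "\<not> tree_le V E r t s"
  have refl: "tree_le V E r t t"
    using tree_le_iff[OF tree] root_path_snoc[OF tree] \<open>t \<in> V\<close>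
    by (metis in_set_conv_decomp)
  have "\<exists>w\<in>C. tree_le V E r w t \<and> w \<noteq> t"
  proof (cases "tree_le V E r s t")
    case True
    then show ?thesis
      using not refl \<open>s \<in> C\<close> by blast
  next
    case False
    then show ?thesis
      using separated[of C t s] not assms by blast
  qed
  then show False
    using C(2) strictly_below_iff[OF tree \<open>t \<in> V\<close>] by blast
qed

text \<open>
  Towards a necklace the tree can only be climbed along a single branch: the part of \<open>V\<close> that stays
  attached to the necklace after deleting everything strictly below \<open>t\<close> lies above \<open>t\<close>, and if it
  still meets \<open>V\<close> after deleting \<open>t\<close> as well, its lowest element is a child of \<open>t\<close>.
\<close>

lemma necklace_climbs_tree:
  assumes N: "necklace \<C> N"
  shows "(\<exists>X. finite X \<and> (\<forall>C\<in>\<C>. C \<inter> X = {} \<and> finite (N - C) \<longrightarrow> C \<inter> V = {})) \<or>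
    (\<exists>t\<in>V. length (root_path V E r t) = Suc n \<and>
       (\<exists>C\<in>\<C>. finite (N - C) \<and> t \<in> C \<and> C \<inter> set (butlast (root_path V E r t)) = {}))"
proof (induction n)
  case 0
  show ?case
  proof (cases "\<exists>C\<in>\<C>. finite (N - C) \<and> C \<inter> V \<noteq> {}")
    case True
    then obtain C s where C: "C \<in> \<C>" "finite (N - C)" "s \<in> C" "s \<in> V"
      by blast
    have "tree_le V E r r s"
      using root_path(1,2)[OF tree C(4)] tree_le_iff[OF tree C(4)]
      by (metis graph_path_def list.set_sel(1))
    then obtain C' where C': "C' \<in> \<C>" "r \<in> C'" "s \<in> C'"
      using linked by blast
    have "C \<union> C' \<in> \<C>"
      using Un_connected C C' by blast
    moreover have "finite (N - (C \<union> C'))"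
      by (rule finite_subset[OF _ C(2)]) blast
    moreover have "r \<in> V"
      using tree by (simp add: rooted_tree_def)
    ultimately show ?thesis
      using C'(2) root_path_root[OF tree] by (intro disjI2 bexI[of _ r]) auto
  next
    case False
    then show ?thesis
      by (intro disjI1 exI[of _ "{}"]) auto
  qed
next
  case (Suc n)
  let ?len = "\<lambda>v. length (root_path V E r v)"
  show ?case
  proof (cases "\<exists>X. finite X \<and> (\<forall>C\<in>\<C>. C \<inter> X = {} \<and> finite (N - C) \<longrightarrow> C \<inter> V = {})")
    case False
    then obtain t C0 where t: "t \<in> V" "?len t = Suc n"
      and C0: "C0 \<in> \<C>" "finite (N - C0)" "t \<in> C0" "C0 \<inter> set (butlast (root_path V E r t)) = {}"
      using Suc by blast
    \<comment> \<open>The failure of the first alternative, applied to the path from the root to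
      \<open>t\<close>, provides such a pair. Below, \<open>s\<close> is chosen of least
      height.\<close>
    define Q where "Q C s \<longleftrightarrow> C \<in> \<C> \<and> C \<inter> set (root_path V E r t) = {} \<and> finite (N - C) \<and> s \<in> C \<and> s \<in> V" for C s
    have "\<exists>s C. Q C s"
      using False unfolding Q_def by (metis List.finite_set disjoint_iff)
    then obtain s where "\<exists>C. Q C s" and least: "\<And>s'. \<exists>C. Q C s' \<Longrightarrow> ?len s \<le> ?len s'"
      using ex_has_least_nat[of "\<lambda>s. \<exists>C. Q C s" _ ?len] by metis
    then obtain C where Cs: "Q C s"
      by blast
    have min: "?len s \<le> ?len s'" if "Q C' s'" for C' s'
      using least that by blast
    have C: "C \<in> \<C>" "C \<inter> set (root_path V E r t) = {}" "finite (N - C)" "s \<in> C" "s \<in> V"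
      using Cs by (auto simp: Q_def)
    have snoc: "root_path V E r t = butlast (root_path V E r t) @ [t]"
      by (rule root_path_snoc[OF tree t(1)])
    have t_in: "t \<in> set (root_path V E r t)"
      by (subst snoc) simp
    have "C \<union> C0 \<in> \<C>"
      using Un_connected C C0 cofinite_parts_meet[OF N C(3) C0(2)] by blast
    moreover have "(C \<union> C0) \<inter> set (butlast (root_path V E r t)) = {}"
      using C(2) C0(4) in_set_butlastD by fast
    ultimately have ts: "tree_le V E r t s"
      using connected_above[of "C \<union> C0" t s] C C0 t by blast
    obtain q where q: "root_path V E r s = root_path V E r t @ q"
      using tree_le_split[OF tree ts] .
    have "s \<noteq> t"
      using C(2,4) t_in by blast
    then have "q \<noteq> []"
      using q root_path(3)[OF tree C(5)] root_path(3)[OF tree t(1)] by auto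
    then obtain p q' where q': "q = p # q'"
      by (cases q) auto
    have ps: "tree_le V E r p s"
      using tree_le_iff[OF tree C(5)] q q' by simp
    have p: "root_path V E r p = root_path V E r t @ [p]"
      using root_path_prefix[OF tree C(5), of "root_path V E r t" p q'] q q' by simp
    \<comment> \<open>\<open>p\<close> is the child of \<open>t\<close> on the way to
      \<open>s\<close>. The set \<open>C1\<close> attaches \<open>p\<close> to \<open>C\<close>
      without touching the path to \<open>t\<close>, so \<open>p\<close> competes with
      \<open>s\<close>, and minimality leaves only \<open>s = p\<close>.\<close>
    obtain C1 where C1: "C1 \<in> \<C>" "p \<in> C1" "s \<in> C1" "\<not> (\<exists>w\<in>C1. tree_le V E r w p \<and> w \<noteq> p)"
      using linked[OF ps] by blast
    have pV: "p \<in> V"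
      using tree_le_in_V[OF tree ps] by blast
    have "C1 \<inter> set (root_path V E r t) = {}"
      using C1(4) strictly_below_iff[OF tree pV] p by auto
    moreover have "C \<union> C1 \<in> \<C>"
      using Un_connected C C1 by blast
    moreover have "finite (N - (C \<union> C1))"
      by (rule finite_subset[OF _ C(3)]) blast
    ultimately have "Q (C \<union> C1) p"
      using C(2) C1(2) pV by (auto simp: Q_def)
    then have "?len s \<le> ?len p"
      by (rule min)
    then have "root_path V E r s = root_path V E r t @ [s]"
      using q q' p root_path(3)[OF tree C(5)] by simp
    then show ?thesis
      using C t by (intro disjI2 bexI[of _ s]) auto
  qed blast
qed

text \<open>Take the vertex \<open>t\<close> that the necklace reaches one level further up. After
  deleting the finitely many vertices strictly below \<open>t\<close>, everything of the tree still
  attached to the necklace lies above \<open>t\<close>, hence beyond level \<open>n\<close>.\<close>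

lemma level_dispersed: "dispersed {v\<in>V. length (root_path V E r v) = n}"
proof (rule dispersedI)
  fix N assume N: "necklace \<C> N"
  let ?L = "{v\<in>V. length (root_path V E r v) = n}"
  consider X where "finite X" "\<forall>C\<in>\<C>. C \<inter> X = {} \<and> finite (N - C) \<longrightarrow> C \<inter> V = {}"
    | t C0 where "t \<in> V" "length (root_path V E r t) = Suc n" "C0 \<in> \<C>" "finite (N - C0)" "t \<in> C0"
      "C0 \<inter> set (butlast (root_path V E r t)) = {}"
    using necklace_climbs_tree[OF N, of n] by blast
  then show "\<exists>X. finite X \<and> (\<forall>C\<in>\<C>. C \<inter> X = {} \<and> finite (N - C) \<longrightarrow> C \<inter> ?L = {})"
  proof cases
    case (1 X)
    then show ?thesis
      by (intro exI[of _ X]) blast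
  next
    case (2 t C0)
    have "C \<inter> ?L = {}"
      if C: "C \<in> \<C>" "C \<inter> set (butlast (root_path V E r t)) = {}" "finite (N - C)" for C
    proof (rule ccontr)
      assume "C \<inter> ?L \<noteq> {}"
      then obtain s where s: "s \<in> C" "s \<in> V" "length (root_path V E r s) = n"
        by blast
      have "C \<union> C0 \<in> \<C>"
        using Un_connected C(1) 2(3) cofinite_parts_meet[OF N C(3) 2(4)] by blast
      then have "tree_le V E r t s"
        using connected_above[of "C \<union> C0" t s] C(2) 2(1,5,6) s by blast
      then show False
        using tree_le_split[OF tree] s(3) 2(2) by (metis Suc_n_not_le_n le_add1 length_append)
    qed
    then show ?thesis
      by (intro exI[of _ "set (butlast (root_path V E r t))"]) auto
  qed
qed

lemma weak_normal_tree_sigma_dispersed: "sigma_dispersed V"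
  unfolding sigma_dispersed_def
  by (rule exI[of _ "\<lambda>n. {v\<in>V. length (root_path V E r v) = n}"]) (use level_dispersed in auto)

end

section \<open>Dispersed sets in induced subconnectoids\<close>

lemma sub_connectoid_space: "K \<subseteq> S \<Longrightarrow> connectoid_space K (sub_connected_sets \<C> K)"
proof
  assume K: "K \<subseteq> S"
  show "C \<subseteq> K" if "C \<in> sub_connected_sets \<C> K" for C
    using that by (simp add: sub_connected_sets_def)
  show "{s} \<in> sub_connected_sets \<C> K" if "s \<in> K" for s
    using that K singleton_connected by (auto simp: sub_connected_sets_def)
  show "\<Union>\<A> \<in> sub_connected_sets \<C> K"
    if "\<A> \<subseteq> sub_connected_sets \<C> K" "\<And>C. C \<in> \<A> \<Longrightarrow> x \<in> C" for \<A> x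
    using that Union_connected[of \<A> x] by (auto simp: sub_connected_sets_def)
  show "\<exists>F\<in>sub_connected_sets \<C> K. finite F \<and> F \<subseteq> C \<and> x \<in> F \<and> y \<in> F"
    if "C \<in> sub_connected_sets \<C> K" "x \<in> C" "y \<in> C" for C x y
    using that finite_connected_witness[of C x y] by (fastforce simp: sub_connected_sets_def)
qed

lemma sub_connected_sets_whole: "sub_connected_sets \<C> S = \<C>"
  using connected_subset by (auto simp: sub_connected_sets_def)

lemma necklace_sub_connected_sets:
  assumes "necklace \<C> N" "N \<subseteq> K"
  shows "necklace (sub_connected_sets \<C> K) N"
proof -
  obtain H :: "nat \<Rightarrow> 'a set" where H: "\<forall>n. finite (H n) \<and> H n \<in> \<C>" "N = (\<Union>n. H n)"
    "\<forall>i j. H i \<inter> H j \<noteq> {} \<longleftrightarrow> \<bar>int i - int j\<bar> \<le> 1"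
    using assms(1) unfolding necklace_def by metis
  have "\<forall>n. finite (H n) \<and> H n \<in> sub_connected_sets \<C> K"
    using H(1,2) assms(2) by (auto simp: sub_connected_sets_def)
  moreover have "N \<in> sub_connected_sets \<C> K"
    using assms necklace_connected by (simp add: sub_connected_sets_def)
  ultimately show ?thesis
    unfolding necklace_def using H(2,3) by (intro conjI exI[of _ H])
qed

text \<open>A connected set that avoids \<open>X\<close> and meets \<open>K\<close> lies in
  \<open>K\<close>. So \<open>N\<close>, once freed from \<open>X\<close>, either is a necklace of
  the subconnectoid or misses \<open>K\<close>; in the latter case no connected set that avoids
  \<open>X\<close> and contains almost all of \<open>N\<close> can reach \<open>A\<close>.\<close>

lemma sub_dispersed:
  assumes K: "K \<in> comps (S - X)" "finite X"
    and A: "connectoid_space.dispersed (sub_connected_sets \<C> K) A" "A \<subseteq> K"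
  shows "dispersed A"
proof (rule dispersedI)
  fix N assume N: "necklace \<C> N"
  have "K \<subseteq> S"
    using component_subset[OF K(1)] by blast
  then interpret sub: connectoid_space K "sub_connected_sets \<C> K"
    by (rule sub_connectoid_space)
  obtain N' where N': "necklace \<C> N'" "N' \<subseteq> N" "N' \<inter> X = {}" "finite (N - N')"
    using necklace_avoiding[OF N K(2)] .
  have into_K: "C \<subseteq> K" if "C \<in> \<C>" "C \<inter> X = {}" "C \<inter> K \<noteq> {}" for C
    using component_absorbs[OF K(1) that(1)] connected_subset that by blast
  show "\<exists>X. finite X \<and> (\<forall>C\<in>\<C>. C \<inter> X = {} \<and> finite (N - C) \<longrightarrow> C \<inter> A = {})"
  proof (cases "N' \<inter> K = {}")
    case True
    have "C \<inter> A = {}" if C: "C \<in> \<C>" "C \<inter> X = {}" "finite (N - C)" for C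
    proof (rule ccontr)
      assume "C \<inter> A \<noteq> {}"
      then have "C \<subseteq> K"
        using into_K[OF C(1,2)] A(2) by blast
      then show False
        using True cofinite_parts_meet[OF N C(3) N'(4)] by blast
    qed
    then show ?thesis
      using K(2) by (intro exI[of _ X]) blast
  next
    case False
    then have "necklace (sub_connected_sets \<C> K) N'"
      using into_K[OF necklace_connected[OF N'(1)] N'(3)] N'(1) necklace_sub_connected_sets by blast
    then obtain Y where Y: "finite Y" "\<And>C. C \<in> sub_connected_sets \<C> K \<Longrightarrow> C \<inter> Y = {} \<Longrightarrow>
        finite (N' - C) \<Longrightarrow> C \<inter> A = {}"
      using sub.dispersedE[OF A(1)] by metis
    have "C \<inter> A = {}" if C: "C \<in> \<C>" "C \<inter> (X \<union> Y) = {}" "finite (N - C)" for C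
    proof (rule ccontr)
      assume "C \<inter> A \<noteq> {}"
      moreover from this have "C \<subseteq> K"
        using into_K[OF C(1)] C(2) A(2) by blast
      moreover have "finite (N' - C)"
        by (rule finite_subset[OF _ C(3)]) (use N'(2) in blast)
      ultimately show False
        using Y(2)[of C] C(1,2) by (auto simp: sub_connected_sets_def)
    qed
    then show ?thesis
      using K(2) Y(1) by (intro exI[of _ "X \<union> Y"]) blast
  qed
qed

lemma sub_normal_tree_sigma_dispersed:
  assumes K: "K \<in> comps (S - X)" "finite X"
    and T: "has_normal_tree_containing K (sub_connected_sets \<C> K) A"
  shows "sigma_dispersed A"
proof -
  have "K \<subseteq> S"
    using component_subset[OF K(1)] by blast
  then interpret sub: connectoid_space K "sub_connected_sets \<C> K"
    by (rule sub_connectoid_space)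
  obtain V E r where V: "weak_normal_tree K (sub_connected_sets \<C> K) V E r" "A \<subseteq> V"
    using T unfolding has_normal_tree_containing_def normal_tree_def by blast
  obtain f where f: "\<And>n. sub.dispersed (f n)" "V \<subseteq> (\<Union>n::nat. f n)"
    using sub.weak_normal_tree_sigma_dispersed[OF V(1)] unfolding sub.sigma_dispersed_def by metis
  \<comment> \<open>Dispersed sets may stick out of the ground set, whereas
    \<open>sub_dispersed\<close> asks for a subset of \<open>K\<close>.\<close>
  have "dispersed (f n \<inter> K)" for n
    by (rule sub_dispersed[OF K sub.dispersed_subset[OF f(1)]]) auto
  moreover have "V \<subseteq> K"
    using V(1) by (simp add: weak_normal_tree_def)
  then have "A \<subseteq> (\<Union>n. f n \<inter> K)"
    using V(2) f(2) by blast
  ultimately show ?thesis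
    unfolding sigma_dispersed_def by (intro exI[of _ "\<lambda>n. f n \<inter> K"]) blast
qed

end

section \<open>From local to global\<close>

context connectoid_space
begin

context
  fixes U :: "'a set"
begin

section \<open>Regions in which \<open>U\<close> is not sigma-dispersed, and traps\<close>

definition bad_region :: "'a set \<Rightarrow> bool" where
  "bad_region D \<longleftrightarrow> (\<exists>X. finite X \<and> D \<in> comps (S - X)) \<and> \<not> sigma_dispersed (U \<inter> D)"

text \<open>Deleting finitely many points beyond \<open>W\<close>, inside a bad component where the
  descent may go on, never leaves \<open>W\<close> in a part with sigma-dispersed trace of
  \<open>U\<close>. As all bad components are covered, \<open>W\<close> can be fixed before the next
  region is chosen.\<close>

definition trap :: "'a set \<Rightarrow> 'a set \<Rightarrow> bool" where
  "trap D W \<longleftrightarrow> (\<forall>K\<in>comps (D - W). bad_region K \<longrightarrow>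
     (\<forall>Y A. finite Y \<and> Y \<subseteq> K \<and> A \<in> comps (D - Y) \<and> W \<subseteq> A \<longrightarrow> \<not> sigma_dispersed (U \<inter> A)))"

lemma bad_region_connected: "bad_region D \<Longrightarrow> D \<in> \<C>"
  using component_connected by (auto simp: bad_region_def)

lemma bad_region_nonempty: "bad_region D \<Longrightarrow> D \<noteq> {}"
  by (auto simp: bad_region_def sigma_dispersed_def intro: dispersed_finite)

lemma bad_region_component:
  assumes "bad_region D" "finite Y" "K \<in> comps (D - Y)" "\<not> sigma_dispersed (U \<inter> K)"
  shows "bad_region K"
proof -
  obtain X where X: "finite X" "D \<in> comps (S - X)"
    using assms(1) by (auto simp: bad_region_def)
  have "K \<noteq> {}"
    using assms(4) by (auto simp: sigma_dispersed_def intro: dispersed_finite)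
  then have "K \<in> comps (S - (X \<union> Y))"
    using component_Diff[OF X(2) assms(3)] by blast
  then show ?thesis
    using X(1) assms(2,4) unfolding bad_region_def by (metis finite_UnI)
qed

lemma bad_region_descend:
  assumes "bad_region D" "finite Y"
  obtains K where "K \<in> comps (D - Y)" "bad_region K"
proof -
  obtain X where X: "finite X" "D \<in> comps (S - X)" "\<not> sigma_dispersed (U \<inter> D)"
    using assms(1) by (auto simp: bad_region_def)
  then obtain K where "K \<in> comps (D - Y)" "\<not> sigma_dispersed (U \<inter> K)"
    using sigma_dispersed_components[OF X(2,1) assms(2), of U] by metis
  then show thesis
    using that bad_region_component[OF assms] by blast
qed

text \<open>
  Without a trap there would be parts \<open>A\<^sub>0 \<subseteq> A\<^sub>1 \<subseteq> \<dots>\<close> with sigma-dispersed trace of \<open>U\<close>, each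
  \<open>A\<^sub>i\<close> being a component of \<open>D - Y\<^sub>i\<close> with \<open>Y\<^sub>i \<subseteq> A\<^sub>i\<^sub>+\<^sub>1\<close>.  A finite connected set meets only finitely many
  of the pairwise disjoint \<open>Y\<^sub>i\<close>, so that the parts exhaust \<open>D\<close>.
\<close>

lemma trap_exists:
  assumes D: "bad_region D"
  shows "\<exists>W. finite W \<and> W \<subseteq> D \<and> W \<noteq> {} \<and> trap D W"
proof (rule ccontr)
  assume no_trap: "\<not> ?thesis"
  have escape: "\<exists>K Y A. K \<in> comps (D - W) \<and> bad_region K \<and> finite Y \<and> Y \<subseteq> K \<and>
      A \<in> comps (D - Y) \<and> W \<subseteq> A \<and> sigma_dispersed (U \<inter> A)"
    if "finite W" "W \<subseteq> D" "W \<noteq> {}" for W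
  proof -
    have "\<not> trap D W"
      using no_trap that by metis
    then show ?thesis
      unfolding trap_def by metis
  qed
  define good where "good p \<longleftrightarrow> finite (fst p) \<and> fst p \<subseteq> D \<and> snd p \<in> comps (D - fst p) \<and> snd p \<noteq> {} \<and>
      sigma_dispersed (U \<inter> snd p)" for p
  have "\<exists>p. \<forall>n. good (p n) \<and> fst (p n) \<union> snd (p n) \<subseteq> snd (p (Suc n))"
  proof (rule dependent_nat_choice)
    obtain x where x: "x \<in> D"
      using bad_region_nonempty[OF D] by blast
    then obtain K Y A where "K \<in> comps (D - {x})" "finite Y" "Y \<subseteq> K" "A \<in> comps (D - Y)" "{x} \<subseteq> A"
      "sigma_dispersed (U \<inter> A)"
      using escape[of "{x}"] by auto
    then have "good (Y, A)"
      using component_subset[of K "D - {x}"] by (auto simp: good_def)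
    then show "\<exists>p. good p" ..
  next
    fix p n assume p: "good p"
    obtain Y A where YA: "p = (Y, A)"
      by fastforce
    have good: "finite Y" "Y \<subseteq> D" "A \<in> comps (D - Y)" "A \<noteq> {}" "sigma_dispersed (U \<inter> A)"
      using p by (simp_all add: good_def YA)
    \<comment> \<open>Asking the next part to contain \<open>a\<close> makes it meet
      \<open>A\<close>, and hence absorb \<open>A\<close>.\<close>
    obtain a where a: "a \<in> A"
      using good(4) by blast
    have "finite (insert a Y)" "insert a Y \<subseteq> D"
      using good(1,2) a component_subset[OF good(3)] by auto
    then obtain K Y' A' where K: "K \<in> comps (D - insert a Y)" "bad_region K" "finite Y'" "Y' \<subseteq> K"
      "A' \<in> comps (D - Y')" "insert a Y \<subseteq> A'" "sigma_dispersed (U \<inter> A')"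
      using escape[of "insert a Y"] by blast
    \<comment> \<open>A bad \<open>K\<close> cannot lie inside \<open>A\<close>, where
      \<open>U\<close> is sigma-dispersed. So the new set \<open>Y'\<close>, lying in
      \<open>K\<close>, leaves \<open>A\<close> intact.\<close>
    have "K \<inter> A = {}"
    proof (rule ccontr)
      assume "K \<inter> A \<noteq> {}"
      moreover have "K \<subseteq> D - Y"
        using component_subset[OF K(1)] by blast
      ultimately have "K \<subseteq> A"
        using component_absorbs[OF good(3)] component_connected[OF K(1)] by blast
      then have "sigma_dispersed (U \<inter> K)"
        by (rule sigma_dispersed_subset[OF good(5) Int_mono[OF subset_refl]])
      then show False
        using K(2) by (simp add: bad_region_def)
    qed
    then have "A \<subseteq> D - Y'"
      using K(4) component_subset[OF good(3)] by blast
    moreover have "A \<inter> A' \<noteq> {}"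
      using a K(6) by blast
    ultimately have "A \<subseteq> A'"
      using component_absorbs[OF K(5) component_connected[OF good(3)]] by blast
    moreover have "Y' \<subseteq> D"
      using K(4) component_subset[OF K(1)] by blast
    ultimately have "good (Y', A') \<and> fst p \<union> snd p \<subseteq> snd (Y', A')"
      using K(3,5,6,7) by (auto simp: good_def YA)
    then show "\<exists>q. good q \<and> fst p \<union> snd p \<subseteq> snd q" ..
  qed
  then obtain p where p: "\<And>n. good (p n)" "\<And>n. fst (p n) \<union> snd (p n) \<subseteq> snd (p (Suc n))"
    by metis
  define Y A where "Y n = fst (p n)" and "A n = snd (p n)" for n
  have Y: "Y n \<subseteq> D" and A: "A n \<in> comps (D - Y n)" "A n \<noteq> {}" "sigma_dispersed (U \<inter> A n)"
    and step: "Y n \<union> A n \<subseteq> A (Suc n)" for n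
    using p[of n] by (auto simp: good_def Y_def A_def)
  have mono: "A m \<subseteq> A n" if "m \<le> n" for m n
    by (rule lift_Suc_mono_le[of A, OF _ that]) (use step in blast)
  have disj: "Y m \<inter> Y n = {}" if "m < n" for m n
  proof -
    have "Y m \<subseteq> A n"
      using step[of m] mono[of "Suc m" n] that by auto
    then show ?thesis
      using component_subset[OF A(1)[of n]] by blast
  qed
  obtain x where x: "x \<in> A 0"
    using A(2) by blast
  have "D \<subseteq> (\<Union>n. A n)"
  proof
    fix y assume y: "y \<in> D"
    have "x \<in> D"
      using x component_subset[OF A(1)] by blast
    then obtain F where F: "F \<in> \<C>" "finite F" "F \<subseteq> D" "x \<in> F" "y \<in> F"
      using finite_connected_witness[OF bad_region_connected[OF D] _ y] by blast
    have "\<exists>n. Y n \<inter> F = {}"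
    proof (rule ccontr)
      assume "\<nexists>n. Y n \<inter> F = {}"
      then have "\<forall>n. \<exists>x. x \<in> Y n \<inter> F"
        by blast
      then obtain g where g: "\<And>n. g n \<in> Y n \<inter> F"
        by metis
      have "inj g"
      proof (rule injI)
        fix m n assume "g m = g n"
        then have "Y m \<inter> Y n \<noteq> {}"
          using g[of m] g[of n] by auto
        then show "m = n"
          using disj by (metis Int_commute nat_neq_iff)
      qed
      moreover have "range g \<subseteq> F"
        using g by blast
      ultimately show False
        using F(2) by (meson finite_imageD finite_subset infinite_UNIV_nat)
    qed
    then obtain n where "Y n \<inter> F = {}" ..
    moreover have "x \<in> A n"
      using x mono[of 0 n] by blast
    ultimately have "F \<subseteq> A n"
      using component_absorbs[OF A(1) F(1)] F(3,4) by blast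
    then show "y \<in> (\<Union>n. A n)"
      using F(5) by blast
  qed
  then have "U \<inter> D \<subseteq> (\<Union>n. U \<inter> A n)"
    by blast
  then have "sigma_dispersed (U \<inter> D)"
    using sigma_dispersed_UN[of "\<lambda>n. U \<inter> A n"] A(3) sigma_dispersed_subset by blast
  then show False
    using D by (simp add: bad_region_def)
qed

text \<open>A bad component of \<open>D - W'\<close> lies in a component of \<open>D - W\<close>,
  which is then bad as well. The lemma allows traps to be made connected and to include prescribed
  points.\<close>

lemma trap_mono:
  assumes D: "bad_region D" and W: "trap D W" "finite W" "W \<subseteq> W'"
  shows "trap D W'"
  unfolding trap_def
proof (intro ballI impI allI)
  fix K' Y A
  assume K': "K' \<in> comps (D - W')" "bad_region K'"
    and YA: "finite Y \<and> Y \<subseteq> K' \<and> A \<in> comps (D - Y) \<and> W' \<subseteq> A"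
  have "K' \<subseteq> D - W"
    using component_subset[OF K'(1)] W(3) by blast
  then obtain K where K: "K \<in> comps (D - W)" "K' \<subseteq> K"
    using component_of_connected[OF bad_region_connected[OF K'(2)] _ bad_region_nonempty[OF K'(2)]]
    by metis
  have "\<not> sigma_dispersed (U \<inter> K)"
    using K'(2) sigma_dispersed_subset[OF _ Int_mono[OF subset_refl K(2)]]
    by (auto simp: bad_region_def)
  then have "bad_region K"
    using bad_region_component[OF D W(2) K(1)] by blast
  then show "\<not> sigma_dispersed (U \<inter> A)"
    using W(1,3) K YA unfolding trap_def by (meson subset_trans)
qed

lemma connected_trap_exists:
  assumes D: "bad_region D" and Z: "finite Z" "Z \<subseteq> D"
  obtains W where "finite W" "W \<in> \<C>" "W \<subseteq> D" "W \<noteq> {}" "Z \<subseteq> W" "trap D W"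
proof -
  obtain W where W: "finite W" "W \<subseteq> D" "trap D W"
    using trap_exists[OF D] by blast
  obtain F where "F \<in> \<C>" "finite F" "W \<union> Z \<subseteq> F" "F \<subseteq> D" "F \<noteq> {}"
    using finite_connected_superset[OF bad_region_connected[OF D], of "W \<union> Z"]
      bad_region_nonempty[OF D] W(1,2) Z by (metis Un_least finite_UnI)
  then show thesis
    using that[of F] trap_mono[OF D W(3,1), of F] by auto
qed

text \<open>The contradiction sits at one late region \<open>D n\<close>: the part of it around the
  tail of the necklace that survives the deletion of \<open>X\<close> contains the trap
  \<open>W n\<close>, yet it lies in \<open>K\<close>, where \<open>U\<close> is
  sigma-dispersed.\<close>

theorem sigma_dispersed_local:
  assumes S: "S \<in> \<C>"
    and local: "\<And>N. necklace \<C> N \<Longrightarrow>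
      \<exists>X. finite X \<and> (\<exists>K\<in>comps (S - X). finite (N - K) \<and> sigma_dispersed (U \<inter> K))"
    and U: "U \<subseteq> S"
  shows "sigma_dispersed U"
proof (rule ccontr)
  assume "\<not> sigma_dispersed U"
  moreover have "S \<in> comps (S - {})"
    using S by (auto simp: ctd_components_def)
  moreover have "U \<inter> S = U"
    using U by blast
  ultimately have bad_S: "bad_region S"
    unfolding bad_region_def by (metis finite.emptyI)
  define good where "good p \<longleftrightarrow> bad_region (fst p) \<and> finite (snd p) \<and> snd p \<in> \<C> \<and> snd p \<subseteq> fst p \<and>
      snd p \<noteq> {} \<and> trap (fst p) (snd p)" for p
  \<comment> \<open>The next trap contains all that \<open>J\<close> has in the next region, so
    \<open>J\<close> is disjoint from every region two or more steps on. This makes the sets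
    \<open>J\<close> locally finite, as \<open>necklace_chain\<close> requires.\<close>
  define link where "link p q \<longleftrightarrow> fst q \<in> comps (fst p - snd p) \<and>
      (\<exists>J\<in>\<C>. finite J \<and> snd p \<subseteq> J \<and> J \<subseteq> fst p \<and> J \<inter> fst q \<noteq> {} \<and> J \<inter> fst q \<subseteq> snd q)" for p q
  have "\<exists>p. \<forall>n. good (p n) \<and> link (p n) (p (Suc n))"
  proof (rule dependent_nat_choice)
    obtain W where "finite W" "W \<in> \<C>" "W \<subseteq> S" "W \<noteq> {}" "{} \<subseteq> W" "trap S W"
      using connected_trap_exists[OF bad_S finite.emptyI empty_subsetI] .
    then have "good (S, W)"
      using bad_S by (simp add: good_def)
    then show "\<exists>p. good p" ..
  next
    fix p n assume "good p"
    then obtain D W where p: "p = (D, W)" and D: "bad_region D" and W: "finite W" "W \<in> \<C>" "W \<subseteq> D"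
      by (cases p) (auto simp: good_def)
    obtain K where K: "K \<in> comps (D - W)" "bad_region K"
      using bad_region_descend[OF D W(1)] .
    obtain x where x: "x \<in> K"
      using bad_region_nonempty[OF K(2)] by blast
    have "insert x W \<subseteq> D"
      using W(3) x component_subset[OF K(1)] by blast
    then obtain J where J: "J \<in> \<C>" "finite J" "insert x W \<subseteq> J" "J \<subseteq> D"
      using finite_connected_superset[OF bad_region_connected[OF D], of "insert x W"]
        bad_region_nonempty[OF D] W(1) by (metis finite_insert)
    obtain W' where W': "finite W'" "W' \<in> \<C>" "W' \<subseteq> K" "W' \<noteq> {}" "J \<inter> K \<subseteq> W'" "trap K W'"
      using connected_trap_exists[OF K(2) finite_Int[OF disjI1[OF J(2)]] Int_lower2] .
    have "good (K, W')"
      using K(2) W' by (simp add: good_def)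
    moreover have "link p (K, W')"
      unfolding link_def p using K(1) J W'(5) x by (auto intro!: bexI[of _ J])
    ultimately show "\<exists>q. good q \<and> link p q"
      by blast
  qed
  then obtain p where p: "\<And>n. good (p n)" "\<And>n. link (p n) (p (Suc n))"
    by metis
  define D W where "D n = fst (p n)" and "W n = snd (p n)" for n
  have D: "bad_region (D n)" and W: "finite (W n)" "trap (D n) (W n)" "W n \<subseteq> D n" "W n \<noteq> {}" for n
    using p(1)[of n] by (simp_all add: good_def D_def W_def)
  have DS: "D (Suc n) \<in> comps (D n - W n)" for n
    using p(2)[of n] by (simp add: link_def D_def W_def)
  have "\<exists>J\<in>\<C>. finite J \<and> W n \<subseteq> J \<and> J \<subseteq> D n \<and> J \<inter> D (Suc n) \<noteq> {} \<and> J \<inter> D (Suc n) \<subseteq> W (Suc n)" for n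
    using p(2)[of n] by (simp add: link_def D_def W_def)
  then obtain J where J: "\<And>n. J n \<in> \<C>" "\<And>n. finite (J n)" "\<And>n. W n \<subseteq> J n" "\<And>n. J n \<subseteq> D n"
    "\<And>n. J n \<inter> D (Suc n) \<noteq> {}" "\<And>n. J n \<inter> D (Suc n) \<subseteq> W (Suc n)"
    by metis
  have D_Suc: "D (Suc n) \<subseteq> D n - W n" for n
    using component_subset[OF DS] .
  have mono: "D n \<subseteq> D m" if "m \<le> n" for m n
    by (rule lift_Suc_antimono_le[of D, OF _ that]) (use D_Suc in blast)
  have J_disj: "J n \<inter> D m = {}" if "Suc (Suc n) \<le> m" for m n
    using mono[OF that] D_Suc[of "Suc n"] D_Suc[of n] J(6)[of n] by blast
  have overlap: "J n \<inter> J (Suc n) \<noteq> {}" for n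
    using J(3)[of "Suc n"] J(5,6)[of n] by blast
  have leave: "\<exists>m. \<forall>i\<ge>m. x \<notin> D i" if "x \<in> (\<Union>n. J n)" for x
    using that J_disj by blast
  define N where "N = (\<Union>n. J n)"
  have N: "necklace \<C> N"
    unfolding N_def
  proof (rule necklace_chain[of J, OF J(2,1) overlap])
    show "\<exists>m. \<forall>i\<ge>m. x \<notin> J i" if "x \<in> (\<Union>n. J n)" for x
      using leave[OF that] J(4) by blast
  qed
  obtain X K where X: "finite X" and K: "K \<in> comps (S - X)" "finite (N - K)" "sigma_dispersed (U \<inter> K)"
    using local[OF N] by blast
  \<comment> \<open>A point lies either in all regions, and then in no \<open>J n\<close>, or from
    some index on in none. For the finite set \<open>X\<close> one index \<open>n\<close> serves all
    points.\<close>
  have "\<exists>k. \<forall>n\<ge>k. x \<notin> J n \<and> (x \<in> D n \<longrightarrow> (\<forall>m. x \<in> D m))" for x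
  proof (cases "\<forall>m. x \<in> D m")
    case True
    then have "x \<notin> (\<Union>n. J n)"
      using leave[of x] by blast
    then show ?thesis
      using True by blast
  next
    case False
    then obtain k where "x \<notin> D k"
      by blast
    then have "x \<notin> D n" if "n \<ge> k" for n
      using mono[OF that] by blast
    then show ?thesis
      using J(4) by blast
  qed
  then obtain k where k: "\<And>x n. k x \<le> n \<Longrightarrow> x \<notin> J n \<and> (x \<in> D n \<longrightarrow> (\<forall>m. x \<in> D m))"
    by metis
  obtain n where "\<forall>i\<in>k ` X. i \<le> n"
    using X finite_nat_set_iff_bounded_le[of "k ` X"] by blast
  then have n: "\<And>x. x \<in> X \<Longrightarrow> k x \<le> n"
    by blast
  define tail where "tail = (\<Union>i. J (i + n))"
  have tail_conn: "tail \<in> \<C>"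
    unfolding tail_def by (rule connected_chain[of "\<lambda>i. J (i + n)"]) (use J(1) overlap in auto)
  have "tail \<subseteq> D n"
    unfolding tail_def using J(4) mono by (meson UN_least le_add2 subset_trans)
  moreover have "tail \<inter> X = {}"
    unfolding tail_def using k n by (fastforce intro: le_trans[OF _ le_add2])
  moreover have Wn: "W n \<subseteq> tail"
  proof -
    have "J (0 + n) \<subseteq> tail"
      unfolding tail_def by (rule UN_upper) simp
    then show ?thesis
      using J(3)[of n] by simp
  qed
  ultimately obtain A where A: "A \<in> comps (D n - X \<inter> D n)" "tail \<subseteq> A"
    using component_of_connected[OF tail_conn, of "D n - X \<inter> D n"] W(4)[of n] by blast
  \<comment> \<open>What remains of \<open>X\<close> in \<open>D n\<close> lies in all regions, so
    \<open>X \<inter> D n\<close> may play the part of \<open>Y\<close> in the trap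
    \<open>W n\<close>, with \<open>D (Suc n)\<close> as the bad component.\<close>
  have "X \<inter> D n \<subseteq> D (Suc n)"
    using k n by blast
  then have not_good: "\<not> sigma_dispersed (U \<inter> A)"
    using W(2)[of n] DS[of n] D[of "Suc n"] A Wn X unfolding trap_def by (meson finite_Int subset_trans)
  have "N - A \<subseteq> (\<Union>i<n. J i)"
  proof
    fix x assume x: "x \<in> N - A"
    then obtain i where i: "x \<in> J i"
      unfolding N_def by blast
    have "i < n"
    proof (rule ccontr)
      assume "\<not> i < n"
      then have "x \<in> J ((i - n) + n)"
        using i by simp
      then show False
        using x A(2) unfolding tail_def by blast
    qed
    then show "x \<in> (\<Union>i<n. J i)"
      using i by blast
  qed
  then have "finite (N - A)"
    by (rule finite_subset) (use J(2) in simp)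
  then have "A \<inter> K \<noteq> {}"
    using cofinite_parts_meet[OF N _ K(2)] by blast
  moreover have "A \<subseteq> S - X"
    using component_subset[OF A(1)] connected_subset[OF bad_region_connected[OF D]] by blast
  ultimately have "A \<subseteq> K"
    using component_absorbs[OF K(1) component_connected[OF A(1)]] by blast
  then show False
    using not_good sigma_dispersed_subset[OF K(3) Int_mono[OF subset_refl]] by blast
qed

end

end

section \<open>Trees given by a parent relation\<close>

text \<open>The measure \<open>d\<close> excludes cycles and keeps descending paths free of
  repetitions. A partial order suffices; in the application \<open>d\<close> is the region of a
  vertex, ordered by inclusion.\<close>

locale parent_relation =
  fixes V :: "'a set" and r :: 'a and P :: "'a \<Rightarrow> 'a \<Rightarrow> bool" and E :: "'a set set"
    and d :: "'a \<Rightarrow> 'b::order"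
  assumes root: "r \<in> V"
    and parent_in: "\<And>u v. P u v \<Longrightarrow> u \<in> V \<and> v \<in> V"
    and reachable: "\<And>v. v \<in> V \<Longrightarrow> P\<^sup>*\<^sup>* r v"
    and parent_unique: "\<And>u u' v. P u v \<Longrightarrow> P u' v \<Longrightarrow> u = u'"
    and root_no_parent: "\<And>u. \<not> P u r"
    and decreasing: "\<And>u v. P u v \<Longrightarrow> d v < d u"
    and E_def: "E = {{u, v} | u v. P u v}"
begin

lemma parent_edge_iff: "{u, v} \<in> E \<longleftrightarrow> P u v \<or> P v u"
  by (auto simp: E_def doubleton_eq_iff)

text \<open>A walk from the root that never turns back immediately can only descend: the root has no
  parent, and the only parent of a later vertex is the one just left. Paths and rays are both of
  this kind.\<close>

lemma parent_chain_step:
  assumes "R 0 = r" "\<And>i. i < n \<Longrightarrow> {R i, R (Suc i)} \<in> E" "\<And>i. Suc i < n \<Longrightarrow> R i \<noteq> R (Suc (Suc i))"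
    and "i < n"
  shows "P (R i) (R (Suc i))"
  using assms(4)
proof (induction i)
  case 0
  then have "{R 0, R (Suc 0)} \<in> E"
    by (rule assms(2))
  then show ?case
    using root_no_parent assms(1) by (auto simp: parent_edge_iff)
next
  case (Suc i)
  then have "P (R i) (R (Suc i))" "R i \<noteq> R (Suc (Suc i))" "{R (Suc i), R (Suc (Suc i))} \<in> E"
    using assms(2,3) by auto
  then show ?case
    using parent_unique by (auto simp: parent_edge_iff)
qed

text \<open>The bound on \<open>d\<close> is the induction invariant: the next vertex has a strictly
  smaller value, hence is new to the path.\<close>

lemma parent_path_extend:
  assumes "P\<^sup>*\<^sup>* u v" "graph_path V E p" "last p = u" "\<forall>x\<in>set p. d u \<le> d x"
  shows "\<exists>q. graph_path V E (p @ q) \<and> last (p @ q) = v \<and> (\<forall>x\<in>set (p @ q). d v \<le> d x)"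
  using assms(1)
proof (induction rule: rtranclp_induct)
  case base
  then show ?case
    using assms by (intro exI[of _ "[]"]) auto
next
  case (step v w)
  then obtain q where q: "graph_path V E (p @ q)" "last (p @ q) = v" "\<forall>x\<in>set (p @ q). d v \<le> d x"
    by blast
  have dw: "d w < d v"
    using decreasing step by blast
  then have w: "\<forall>x\<in>set (p @ q). d w < d x"
    using q(3) less_le_trans by blast
  then have "graph_path V E ((p @ q) @ [w])"
    using q(1,2) parent_in[OF step.hyps(2)] step.hyps(2) less_irrefl
    unfolding graph_path_iff_successively successively_append_iff[of _ "p @ q" "[w]"]
    by (auto simp: parent_edge_iff)
  then show ?case
    using w by (intro exI[of _ "q @ [w]"]) (auto intro: less_imp_le)
qed

lemma parent_rooted_tree: "rooted_tree V E r"
  unfolding rooted_tree_def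
proof (intro conjI ballI)
  have ne: "u \<noteq> v" if "P u v" for u v
    using decreasing[OF that] by auto
  show "simple_graph V E"
    unfolding simple_graph_def E_def using parent_in ne by blast
  show "r \<in> V"
    by (rule root)
  have sym: "\<exists>p. graph_path V E p \<and> hd p = u \<and> last p = v"
    if "(\<lambda>x y. {x, y} \<in> E)\<^sup>*\<^sup>* u v" "u \<in> V" for u v
    using that
  proof (induction rule: rtranclp_induct)
    case base
    then show ?case
      by (intro exI[of _ "[u]"]) (auto simp: graph_path_def)
  next
    case (step v w)
    then obtain p where p: "graph_path V E p" "hd p = u" "last p = v"
      by blast
    show ?case
    proof (cases "w \<in> set p")
      case True
      then obtain q q' where q: "p = (q @ [w]) @ q'"
        by (metis append.assoc append_Cons append_Nil split_list)
      then have "graph_path V E (q @ [w])"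
        using p graph_path_append1 by blast
      moreover have "hd (q @ [w]) = u"
        using p(2) q by (cases q) auto
      ultimately show ?thesis
        by auto
    next
      case False
      have "w \<in> V"
        using step.hyps(2) parent_in by (auto simp: parent_edge_iff)
      then have "graph_path V E (p @ [w])"
        using p False step.hyps(2) by (auto simp: graph_path_iff_successively successively_append_iff)
      moreover have "hd (p @ [w]) = u"
        using p by (auto simp: graph_path_def)
      ultimately show ?thesis
        by auto
    qed
  qed
  fix u v assume uv: "u \<in> V" "v \<in> V"
  let ?R = "\<lambda>x y. {x, y} \<in> E"
  have "P\<^sup>*\<^sup>* x y \<Longrightarrow> ?R\<^sup>*\<^sup>* x y" for x y
    by (rule rtranclp_mono[THEN predicate2D]) (auto simp: parent_edge_iff)
  moreover have "symp ?R\<^sup>*\<^sup>*"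
    by (rule symp_rtranclp) (auto simp: symp_def insert_commute)
  ultimately have "?R\<^sup>*\<^sup>* u r" "?R\<^sup>*\<^sup>* r v"
    using reachable uv by (auto dest: sympD)
  then have "?R\<^sup>*\<^sup>* u v"
    by (rule rtranclp_trans)
  then show "\<exists>p. graph_path V E p \<and> hd p = u \<and> last p = v"
    using sym uv by blast
next
  show "\<not> (\<exists>p. graph_cycle V E p)"
  proof
    assume "\<exists>p. graph_cycle V E p"
    then obtain p where path: "graph_path V E p" and len: "3 \<le> length p" and close: "{last p, hd p} \<in> E"
      unfolding graph_cycle_def by blast
    define n where "n = length p"
    define f where "f i = p ! (i mod n)" for i
    have n: "3 \<le> n" and dist: "distinct p"
      using len path by (auto simp: n_def graph_path_def)
    have edge: "{f i, f (Suc i)} \<in> E" for i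
    proof (cases "Suc (i mod n) < n")
      case True
      then have "Suc i mod n = Suc (i mod n)"
        by (simp add: mod_Suc)
      then show ?thesis
        using path True by (auto simp: f_def graph_path_def n_def)
    next
      case False
      moreover have "i mod n < n"
        using n by simp
      ultimately have "Suc (i mod n) = n"
        by linarith
      then have "i mod n = n - 1" "Suc i mod n = 0"
        by (auto simp: mod_Suc)
      then show ?thesis
        using close n by (cases "p = []") (auto simp: f_def n_def last_conv_nth hd_conv_nth)
    qed
    have "finite (d ` set p)" "d ` set p \<noteq> {}"
      using len by auto
    then obtain m where m: "m \<in> d ` set p" "\<forall>x\<in>d ` set p. x \<le> m \<longrightarrow> m = x"
      using finite_has_minimal by metis
    then obtain j where j: "j < n" "m = d (p ! j)"
      by (auto simp: in_set_conv_nth n_def)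
    \<comment> \<open>The cyclic predecessor of \<open>j\<close>; adding \<open>n\<close> avoids
      truncated subtraction at \<open>j = 0\<close>.\<close>
    define i where "i = n + j - 1"
    have i: "f (Suc i) = p ! j"
      using n j by (simp add: f_def i_def)
    have le: "\<not> d (f k) < d (p ! j)" for k
    proof -
      have "k mod n < n"
        using n by simp
      then have "f k \<in> set p"
        by (simp add: f_def n_def)
      then show ?thesis
        using m(2) j(2) by auto
    qed
    \<comment> \<open>Neither cycle neighbour of a vertex with minimal \<open>d\<close> can be its
      child, so both are its parent and coincide. With at least three vertices on the cycle they
      differ.\<close>
    have "P (f i) (p ! j)" "P (f (Suc (Suc i))) (p ! j)"
      using edge[of i] edge[of "Suc i"] i le decreasing by (auto simp: parent_edge_iff)
    then have "f i = f (Suc (Suc i))"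
      using parent_unique by blast
    moreover have "k mod n < length p" for k
      using n by (simp add: n_def[symmetric])
    ultimately have "i mod n = Suc (Suc i) mod n"
      using nth_eq_iff_index_eq[OF dist] by (simp add: f_def)
    then have "n dvd 2"
      by (metis add_2_eq_Suc add_diff_cancel_right' le_add2 mod_eq_dvd_iff_nat)
    then show False
      using n by (auto dest: dvd_imp_le)
  qed
qed

lemma parent_tree_le_iff:
  assumes "v \<in> V"
  shows "tree_le V E r u v \<longleftrightarrow> u \<in> V \<and> P\<^sup>*\<^sup>* u v"
proof
  assume "tree_le V E r u v"
  then obtain p where p: "graph_path V E p" "hd p = r" "last p = v" "u \<in> set p"
    unfolding tree_le_def by blast
  define n where "n = length p - 1"
  have len: "length p = Suc n"
    using p(4) by (cases p) (auto simp: n_def)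
  have step: "P (p ! i) (p ! Suc i)" if "i < n" for i
  proof (rule parent_chain_step[of "(!) p" n])
    show "p ! 0 = r"
      using p(2) len by (cases p) auto
    show "p ! i \<noteq> p ! Suc (Suc i)" if "Suc i < n" for i
      using p(1) len that by (auto simp: graph_path_def nth_eq_iff_index_eq)
  qed (use p(1) len that in \<open>auto simp: graph_path_def\<close>)
  obtain i where i: "i \<le> n" "u = p ! i"
    using p(4) len by (auto simp: in_set_conv_nth less_Suc_eq_le)
  have "k \<le> n \<Longrightarrow> P\<^sup>*\<^sup>* (p ! i) (p ! k)" if "i \<le> k" for k
    using that by (induction k rule: dec_induct) (auto intro: rtranclp.rtrancl_into_rtrancl[where r = P, OF _ step])
  then have "P\<^sup>*\<^sup>* (p ! i) (p ! n)"
    using i(1) by blast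
  moreover have "p ! n = v"
    using p(3) len by (cases p) (auto simp: last_conv_nth)
  moreover have "u \<in> V"
    using p by (auto simp: graph_path_def)
  ultimately show "u \<in> V \<and> P\<^sup>*\<^sup>* u v"
    using i by simp
next
  assume u: "u \<in> V \<and> P\<^sup>*\<^sup>* u v"
  obtain p where p: "graph_path V E ([r] @ p)" "last ([r] @ p) = u" "\<forall>x\<in>set ([r] @ p). d u \<le> d x"
    using parent_path_extend[of r u "[r]"] reachable u root by (auto simp: graph_path_def)
  obtain q where q: "graph_path V E (([r] @ p) @ q)" "last (([r] @ p) @ q) = v"
    using parent_path_extend[OF _ p] u by blast
  have "u \<in> set ([r] @ p)"
    using p(2) last_in_set[of "[r] @ p"] by simp
  then have "u \<in> set (([r] @ p) @ q)"
    by auto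
  moreover have "hd (([r] @ p) @ q) = r"
    by simp
  ultimately show "tree_le V E r u v"
    using q unfolding tree_le_def by blast
qed

lemma parent_ray:
  assumes "ray_from V E r R"
  shows "P (R i) (R (Suc i))"
proof (rule parent_chain_step[of R "Suc i"])
  show "R i \<noteq> R (Suc (Suc i))" for i
    using assms by (auto simp: ray_from_def inj_eq)
qed (use assms in \<open>auto simp: ray_from_def\<close>)

end

section \<open>Trees of nested regions\<close>

text \<open>Nodes are abstract states because the application attaches a queue to each region.
  Components may be passed over, but by \<open>child_unique\<close> none is used twice by the same
  state, so regions of different children are disjoint.\<close>

locale nested_regions = connectoid_space S \<C> for S :: "'a set" and \<C> +
  fixes s0 :: 's and child :: "'s \<Rightarrow> 's \<Rightarrow> bool" and D :: "'s \<Rightarrow> 'a set" and t :: "'s \<Rightarrow> 'a"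
  assumes S_connected: "S \<in> \<C>"
    and D_root: "D s0 = S"
    and t_in_D: "\<And>s. child\<^sup>*\<^sup>* s0 s \<Longrightarrow> t s \<in> D s"
    and child_component: "\<And>s s'. child\<^sup>*\<^sup>* s0 s \<Longrightarrow> child s s' \<Longrightarrow> D s' \<in> comps (D s - {t s})"
    and child_unique: "\<And>s s' s''. child s s' \<Longrightarrow> child s s'' \<Longrightarrow> D s' = D s'' \<Longrightarrow> s' = s''"
begin

definition V :: "'a set" where
  "V = t ` {s. child\<^sup>*\<^sup>* s0 s}"

definition E :: "'a set set" where
  "E = {{t s, t s'} | s s'. child\<^sup>*\<^sup>* s0 s \<and> child s s'}"

abbreviation r :: 'a where
  "r \<equiv> t s0"

lemma child_region: "child\<^sup>*\<^sup>* s0 s \<Longrightarrow> child s s' \<Longrightarrow> D s' \<subseteq> D s - {t s}"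
  using component_subset child_component by blast

lemma descendant_region:
  assumes "child\<^sup>*\<^sup>* s s'" "child\<^sup>*\<^sup>* s0 s"
  shows "D s' \<subseteq> D s"
  using assms(1)
proof (induction rule: rtranclp_induct)
  case (step s' s'')
  have "child\<^sup>*\<^sup>* s0 s'"
    using assms(2) step.hyps(1) by simp
  then show ?case
    using step.IH child_region step.hyps(2) by blast
qed simp

lemma proper_descendant_region:
  assumes "child\<^sup>+\<^sup>+ s s'" "child\<^sup>*\<^sup>* s0 s"
  shows "D s' \<subseteq> D s - {t s}"
proof -
  obtain z where z: "child s z" "child\<^sup>*\<^sup>* z s'"
    using tranclpD[OF assms(1)] by blast
  have "child\<^sup>*\<^sup>* s0 z"
    using assms(2) z(1) by simp
  then show ?thesis
    using descendant_region[OF z(2)] child_region[OF assms(2) z(1)] by blast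
qed

text \<open>The regions form a laminar family, since siblings have different components of the same
  set as regions.\<close>

lemma overlapping_regions:
  assumes "child\<^sup>*\<^sup>* s0 s" "child\<^sup>*\<^sup>* s0 s'" "D s \<inter> D s' \<noteq> {}"
  shows "child\<^sup>*\<^sup>* s s' \<or> child\<^sup>*\<^sup>* s' s"
  using assms(1,3)
proof (induction rule: rtranclp_induct)
  case base
  then show ?case using assms(2) by simp
next
  case (step s s1)
  have "D s \<inter> D s' \<noteq> {}"
    using step.prems child_region[OF step.hyps] by blast
  then consider "child\<^sup>*\<^sup>* s' s" | "s' = s" | z where "child s z" "child\<^sup>*\<^sup>* z s'"
    using step.IH by (metis converse_rtranclpE)
  then show ?case
  proof cases
    case (3 z)
    have "child\<^sup>*\<^sup>* s0 z"
      using step.hyps(1) 3(1) by simp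
    then have "D s1 \<inter> D z \<noteq> {}"
      using step.prems descendant_region[OF 3(2)] by blast
    then have "D s1 = D z"
      using component_eqI child_component step.hyps 3(1) by blast
    then have "s1 = z"
      using child_unique step.hyps(2) 3(1) by blast
    then show ?thesis
      using 3(2) by simp
  next
    case 1
    then show ?thesis
      using step.hyps(2) by (meson rtranclp.rtrancl_into_rtrancl)
  qed (use step.hyps(2) in auto)
qed

lemma vertex_in_region:
  assumes "child\<^sup>*\<^sup>* s0 s" "child\<^sup>*\<^sup>* s0 s'" "t s' \<in> D s"
  shows "child\<^sup>*\<^sup>* s s'"
proof (rule ccontr)
  assume not: "\<not> child\<^sup>*\<^sup>* s s'"
  have "D s \<inter> D s' \<noteq> {}"
    using t_in_D[OF assms(2)] assms(3) by blast
  then have "child\<^sup>*\<^sup>* s' s"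
    using overlapping_regions[OF assms(1,2)] not by blast
  then have "child\<^sup>+\<^sup>+ s' s"
    using not by (metis rtranclpD rtranclp.rtrancl_refl)
  then show False
    using proper_descendant_region assms(2,3) by blast
qed

lemma vertex_inj:
  assumes "child\<^sup>*\<^sup>* s0 s" "child\<^sup>*\<^sup>* s0 s'" "t s = t s'"
  shows "s = s'"
proof (rule ccontr)
  assume "s \<noteq> s'"
  have "child\<^sup>*\<^sup>* s s'"
    using vertex_in_region[OF assms(1,2)] t_in_D[OF assms(1)] assms(3) by simp
  then have "child\<^sup>+\<^sup>+ s s'"
    using \<open>s \<noteq> s'\<close> by (metis rtranclpD)
  then have "t s' \<noteq> t s"
    using proper_descendant_region assms(1) t_in_D[OF assms(2)] by blast
  then show False
    using assms(3) by simp
qed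

text \<open>If \<open>y\<close> were a proper descendant of another parent \<open>x\<close> of
  \<open>s\<close>, then \<open>D s\<close> would be the region of the child of \<open>x\<close>
  towards \<open>y\<close>, and so would contain \<open>D y\<close>, although \<open>t y\<close> is
  missing from \<open>D s\<close>.\<close>

lemma parent_state_unique:
  assumes "child\<^sup>*\<^sup>* s0 a" "child\<^sup>*\<^sup>* s0 b" "child a s" "child b s"
  shows "a = b"
proof -
  have "child\<^sup>*\<^sup>* s0 s"
    using assms(1,3) by simp
  then have ts: "t s \<in> D s"
    by (rule t_in_D)
  have no: False
    if xy: "child\<^sup>+\<^sup>+ x y" "child x s" "child y s" "child\<^sup>*\<^sup>* s0 x" for x y
  proof -
    obtain z where z: "child x z" "child\<^sup>*\<^sup>* z y"
      using tranclpD[OF xy(1)] by blast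
    have reach: "child\<^sup>*\<^sup>* s0 z" "child\<^sup>*\<^sup>* s0 y"
      using xy(4) z by (auto intro: rtranclp_trans)
    then have sub: "D s \<subseteq> D y - {t y}" "D y \<subseteq> D z"
      using child_region[OF reach(2) xy(3)] descendant_region[OF z(2) reach(1)] by auto
    then have "D s = D z"
      using component_eqI[of "D s" "D x - {t x}" "D z"] child_component[OF xy(4)] xy(2) z(1) ts
      by blast
    then show False
      using sub t_in_D[OF reach(2)] by blast
  qed
  have "D a \<inter> D b \<noteq> {}"
    using ts child_region assms by blast
  then have "child\<^sup>*\<^sup>* a b \<or> child\<^sup>*\<^sup>* b a"
    by (rule overlapping_regions[OF assms(1,2)])
  then show "a = b"
    using no[of a b] no[of b a] assms by (metis rtranclpD)
qed

text \<open>At the first state on the way to \<open>s\<close> whose child region no longer contains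
  all of \<open>C\<close>, the set \<open>C\<close> must use the deleted vertex; otherwise it would
  be absorbed by the component.\<close>

lemma leaving_connected_set:
  assumes "child\<^sup>*\<^sup>* s0 s" "C \<in> \<C>" "C \<inter> D s \<noteq> {}" "\<not> C \<subseteq> D s"
  shows "\<exists>a. child\<^sup>*\<^sup>* s0 a \<and> child\<^sup>+\<^sup>+ a s \<and> t a \<in> C"
  using assms(1,3,4)
proof (induction rule: rtranclp_induct)
  case base
  then show ?case
    using D_root connected_subset[OF assms(2)] by simp
next
  case (step s s1)
  show ?case
  proof (cases "C \<subseteq> D s")
    case True
    have "t s \<in> C"
    proof (rule ccontr)
      assume "t s \<notin> C"
      then have "C \<subseteq> D s - {t s}"
        using True by blast
      then show False
        using component_absorbs[OF child_component[OF step.hyps] assms(2)] step.prems by blast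
    qed
    then show ?thesis
      using step.hyps by blast
  next
    case False
    have "C \<inter> D s \<noteq> {}"
      using step.prems(1) child_region[OF step.hyps] by blast
    then show ?thesis
      using step.IH[OF _ False] step.hyps(2) by (meson tranclp.trancl_into_trancl)
  qed
qed

section \<open>From states to vertices\<close>

definition vertex_parent :: "'a \<Rightarrow> 'a \<Rightarrow> bool" where
  "vertex_parent u v \<longleftrightarrow> (\<exists>s s'. child\<^sup>*\<^sup>* s0 s \<and> child s s' \<and> u = t s \<and> v = t s')"

lemma vertex_parentE:
  assumes "vertex_parent u v"
  obtains s s' where "child\<^sup>*\<^sup>* s0 s" "child s s'" "u = t s" "v = t s'"
  using assms unfolding vertex_parent_def by metis

definition vertex_region :: "'a \<Rightarrow> 'a set" where
  "vertex_region v = D (SOME s. child\<^sup>*\<^sup>* s0 s \<and> t s = v)"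

lemma vertex_region:
  assumes "child\<^sup>*\<^sup>* s0 s"
  shows "vertex_region (t s) = D s"
proof -
  have "(SOME s'. child\<^sup>*\<^sup>* s0 s' \<and> t s' = t s) = s"
    using assms vertex_inj by (intro some_equality) auto
  then show ?thesis
    by (simp add: vertex_region_def)
qed

lemma vertex_parent_iff:
  assumes "child\<^sup>*\<^sup>* s0 s" "child\<^sup>*\<^sup>* s0 s'"
  shows "vertex_parent (t s) (t s') \<longleftrightarrow> child s s'"
proof
  assume "vertex_parent (t s) (t s')"
  then obtain a b where ab: "child\<^sup>*\<^sup>* s0 a" "child a b" "t s = t a" "t s' = t b"
    by (rule vertex_parentE)
  moreover have "child\<^sup>*\<^sup>* s0 b"
    using ab by simp
  ultimately show "child s s'"
    using vertex_inj assms by metis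
qed (use assms vertex_parent_def in blast)

lemma vertex_parent_rtranclp:
  assumes "child\<^sup>*\<^sup>* s s'" "child\<^sup>*\<^sup>* s0 s"
  shows "vertex_parent\<^sup>*\<^sup>* (t s) (t s')"
  using assms(1)
proof (induction rule: rtranclp_induct)
  case (step s' s'')
  have "child\<^sup>*\<^sup>* s0 s'"
    using assms(2) step.hyps(1) by simp
  then have "vertex_parent (t s') (t s'')"
    using step.hyps(2) unfolding vertex_parent_def by blast
  then show ?case
    using step.IH by simp
qed simp

lemma vertex_parent_rtranclpD:
  assumes "vertex_parent\<^sup>*\<^sup>* (t s) v" "child\<^sup>*\<^sup>* s0 s"
  shows "\<exists>s'. child\<^sup>*\<^sup>* s s' \<and> v = t s'"
  using assms(1)
proof (induction rule: rtranclp_induct)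
  case base
  then show ?case
    by (intro exI[of _ s]) simp
next
  case (step v w)
  then obtain s' where s': "child\<^sup>*\<^sup>* s s'" "v = t s'"
    by blast
  then have reach: "child\<^sup>*\<^sup>* s0 s'"
    using assms(2) by simp
  obtain a b where ab: "child\<^sup>*\<^sup>* s0 a" "child a b" "v = t a" "w = t b"
    using vertex_parentE[OF step.hyps(2)] .
  have "t a = t s'"
    using ab(3) s'(2) by metis
  then have "a = s'"
    by (rule vertex_inj[OF ab(1) reach])
  then have "child\<^sup>*\<^sup>* s b"
    using s'(1) ab(2) by simp
  then show ?case
    using ab(4) by (intro exI[of _ b]) simp
qed

sublocale tree: parent_relation V r vertex_parent E vertex_region
proof
  show "r \<in> V"
    by (auto simp: V_def)
  show "u \<in> V \<and> v \<in> V" if "vertex_parent u v" for u v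
  proof -
    obtain a b where ab: "child\<^sup>*\<^sup>* s0 a" "child a b" "u = t a" "v = t b"
      using vertex_parentE[OF \<open>vertex_parent u v\<close>] .
    moreover have "child\<^sup>*\<^sup>* s0 b"
      using ab(1,2) by simp
    ultimately show ?thesis
      unfolding V_def by blast
  qed
  show "vertex_parent\<^sup>*\<^sup>* r v" if "v \<in> V" for v
    using that vertex_parent_rtranclp by (auto simp: V_def)
  show "u = u'" if uv: "vertex_parent u v" "vertex_parent u' v" for u u' v
  proof -
    obtain a b a' b' where ab: "child\<^sup>*\<^sup>* s0 a" "child a b" "u = t a" "v = t b"
      "child\<^sup>*\<^sup>* s0 a'" "child a' b'" "u' = t a'" "v = t b'"
      using vertex_parentE[OF uv(1)] vertex_parentE[OF uv(2)] by metis
    have "child\<^sup>*\<^sup>* s0 b" "child\<^sup>*\<^sup>* s0 b'"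
      using ab by auto
    then have "b = b'"
      using vertex_inj ab by metis
    then show ?thesis
      using parent_state_unique ab by metis
  qed
  show "\<not> vertex_parent u r" for u
  proof
    assume "vertex_parent u r"
    then obtain a b where ab: "child\<^sup>*\<^sup>* s0 a" "child a b" "t s0 = t b"
      by (rule vertex_parentE)
    have "child\<^sup>*\<^sup>* s0 b"
      using ab by simp
    then have "b = s0"
      by (rule vertex_inj) (simp_all add: ab(3))
    then have "S \<subseteq> D a - {t a}"
      using child_region[OF ab(1,2)] D_root by simp
    moreover have "D a \<subseteq> S"
      using descendant_region[OF ab(1)] D_root by simp
    ultimately show False
      using t_in_D[OF ab(1)] by blast
  qed
  show "vertex_region v < vertex_region u" if "vertex_parent u v" for u v
  proof -
    obtain a b where ab: "child\<^sup>*\<^sup>* s0 a" "child a b" "u = t a" "v = t b"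
      using vertex_parentE[OF \<open>vertex_parent u v\<close>] .
    have "child\<^sup>*\<^sup>* s0 b"
      using ab by simp
    then have "vertex_region v = D b" "vertex_region u = D a"
      using ab vertex_region by simp_all
    then show ?thesis
      using child_region[OF ab(1,2)] t_in_D[OF ab(1)] by blast
  qed
  show "E = {{u, v} | u v. vertex_parent u v}"
    unfolding E_def vertex_parent_def by blast
qed

lemma nested_tree_le_iff:
  assumes "child\<^sup>*\<^sup>* s0 s" "child\<^sup>*\<^sup>* s0 s'"
  shows "tree_le V E r (t s) (t s') \<longleftrightarrow> child\<^sup>*\<^sup>* s s'"
proof -
  have "t s \<in> V" "t s' \<in> V"
    using assms by (auto simp: V_def)
  then have "tree_le V E r (t s) (t s') \<longleftrightarrow> vertex_parent\<^sup>*\<^sup>* (t s) (t s')"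
    using tree.parent_tree_le_iff by blast
  also have "\<dots> \<longleftrightarrow> child\<^sup>*\<^sup>* s s'"
  proof
    assume "vertex_parent\<^sup>*\<^sup>* (t s) (t s')"
    then obtain s'' where s'': "child\<^sup>*\<^sup>* s s''" "t s' = t s''"
      using vertex_parent_rtranclpD assms(1) by blast
    have "child\<^sup>*\<^sup>* s0 s''"
      using assms(1) s''(1) by (rule rtranclp_trans)
    then have "s' = s''"
      by (rule vertex_inj[OF assms(2) _ s''(2)])
    then show "child\<^sup>*\<^sup>* s s'"
      using s''(1) by simp
  qed (use vertex_parent_rtranclp assms in blast)
  finally show ?thesis .
qed

lemma nested_tree_leE:
  assumes "tree_le V E r u v"
  obtains s s' where "child\<^sup>*\<^sup>* s0 s" "child\<^sup>*\<^sup>* s0 s'" "u = t s" "v = t s'" "child\<^sup>*\<^sup>* s s'"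
proof -
  have "u \<in> V" "v \<in> V"
    using tree_le_in_V[OF tree.parent_rooted_tree assms] by auto
  then obtain s s' where s: "child\<^sup>*\<^sup>* s0 s" "child\<^sup>*\<^sup>* s0 s'" "u = t s" "v = t s'"
    by (auto simp: V_def)
  then have "child\<^sup>*\<^sup>* s s'"
    using assms nested_tree_le_iff by simp
  then show thesis
    using that s by blast
qed

text \<open>For comparable vertices the region of the lower one is the required connected set: all
  vertices strictly below it were deleted before. For incomparable ones the common lower bound is
  found where their branches part, or further down.\<close>

lemma nested_weak_normal_tree: "weak_normal_tree S \<C> V E r"
  unfolding weak_normal_tree_def
proof (intro conjI ballI impI)
  show "rooted_tree V E r"
    by (rule tree.parent_rooted_tree)
  have DS: "D s \<subseteq> S" if "child\<^sup>*\<^sup>* s0 s" for s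
    using descendant_region[OF that] D_root by simp
  show "V \<subseteq> S"
    using DS t_in_D by (auto simp: V_def)
  have D_conn: "D s \<in> \<C>" if "child\<^sup>*\<^sup>* s0 s" for s
    using that
  proof (cases rule: rtranclp.cases)
    case (rtrancl_into_rtrancl b)
    then show ?thesis
      using child_component component_connected by blast
  qed (use D_root S_connected in simp)
  {
    fix C u v
    assume C: "C \<in> \<C>" and "u \<in> C \<inter> V" "v \<in> C \<inter> V"
      and incomp: "\<not> tree_le V E r u v \<and> \<not> tree_le V E r v u"
    then obtain s s' where s: "child\<^sup>*\<^sup>* s0 s" "u = t s" "u \<in> C" and s': "child\<^sup>*\<^sup>* s0 s'" "v = t s'" "v \<in> C"
      by (auto simp: V_def)
    have "v \<notin> D s"
      using vertex_in_region[OF s(1) s'(1)] nested_tree_le_iff[OF s(1) s'(1)] incomp s(2) s'(2) by blast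
    have vS: "v \<in> D s0"
      using t_in_D[OF s'(1)] DS[OF s'(1)] s'(2) D_root by blast
    \<comment> \<open>\<open>b\<close> is the last state on the branch to \<open>s\<close> whose
      region still contains \<open>v\<close>.\<close>
    have "\<exists>b c. child\<^sup>*\<^sup>* s0 b \<and> child b c \<and> child\<^sup>*\<^sup>* c s \<and> v \<in> D b \<and> v \<notin> D c"
      using s(1) \<open>v \<notin> D s\<close>
    proof (induction rule: rtranclp_induct)
      case (step b c)
      then show ?case
        by (cases "v \<in> D b") (blast, meson rtranclp.rtrancl_into_rtrancl)
    qed (use vS in blast)
    then obtain b c where bc: "child\<^sup>*\<^sup>* s0 b" "child b c" "child\<^sup>*\<^sup>* c s" "v \<in> D b" "v \<notin> D c"
      by blast
    have c: "child\<^sup>*\<^sup>* s0 c"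
      using bc by simp
    have "u \<in> D c"
      using descendant_region[OF bc(3) c] t_in_D[OF s(1)] s(2) by blast
    \<comment> \<open>Either \<open>C\<close> stays in \<open>D b\<close>, and then needs
      \<open>t b\<close> to join \<open>u\<close> to \<open>v\<close>, or it leaves
      \<open>D b\<close> and contains the vertex of a proper ancestor of \<open>b\<close>.\<close>
    obtain a where a: "child\<^sup>*\<^sup>* s0 a" "child\<^sup>*\<^sup>* a b" "t a \<in> C"
    proof (cases "C \<subseteq> D b")
      case True
      have "t b \<in> C"
      proof (rule ccontr)
        assume "t b \<notin> C"
        then have "C \<subseteq> D b - {t b}"
          using True by blast
        then have "C \<subseteq> D c"
          using component_absorbs[OF child_component[OF bc(1,2)] C] s(3) \<open>u \<in> D c\<close> by blast
        then show False
          using bc(5) s'(3) by blast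
      qed
      then show ?thesis
        using that[of b] bc(1) by simp
    next
      case False
      then obtain a where "child\<^sup>*\<^sup>* s0 a" "child\<^sup>+\<^sup>+ a b" "t a \<in> C"
        using leaving_connected_set[OF bc(1) C] bc(4) s'(3) by blast
      then show ?thesis
        using that tranclp_into_rtranclp by metis
    qed
    have "child\<^sup>*\<^sup>* a s"
      using a(2) bc(2,3) by (meson converse_rtranclp_into_rtranclp rtranclp_trans)
    moreover have "child\<^sup>*\<^sup>* a s'"
      using a(2) vertex_in_region[OF bc(1) s'(1)] bc(4) s'(2) by simp
    ultimately have "tree_le V E r (t a) u \<and> tree_le V E r (t a) v"
      using nested_tree_le_iff a(1) s(1,2) s'(1,2) by simp
    then show "\<exists>w\<in>C. tree_le V E r w u \<and> tree_le V E r w v"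
      using a(3) by blast
  }
  fix u v assume "tree_le V E r u v"
  then obtain s s' where s: "child\<^sup>*\<^sup>* s0 s" "child\<^sup>*\<^sup>* s0 s'" "u = t s" "v = t s'" "child\<^sup>*\<^sup>* s s'"
    by (rule nested_tree_leE)
  have "v \<in> D s"
    using descendant_region[OF s(5,1)] t_in_D[OF s(2)] s(4) by blast
  moreover have "w \<notin> D s" if w: "tree_le V E r w u" "w \<noteq> u" for w
  proof -
    obtain a b where a: "child\<^sup>*\<^sup>* s0 a" "child\<^sup>*\<^sup>* s0 b" "w = t a" "u = t b" "child\<^sup>*\<^sup>* a b"
      using w(1) by (rule nested_tree_leE)
    have "t b = t s"
      using a(4) s(3) by metis
    then have "b = s"
      by (rule vertex_inj[OF a(2) s(1)])
    then have "child\<^sup>+\<^sup>+ a s"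
      using a(3,4,5) w(2) by (metis rtranclpD)
    then show ?thesis
      using proper_descendant_region a(1,3) by blast
  qed
  ultimately show "\<exists>C\<in>\<C>. u \<in> C \<and> v \<in> C \<and> \<not> (\<exists>w\<in>C. tree_le V E r w u \<and> w \<noteq> u)"
    using t_in_D[OF s(1)] s(3) D_conn[OF s(1)] by (intro bexI[of _ "D s"]) auto
qed

lemma nested_tree_ray:
  assumes "ray_from V E r R"
  obtains s where "\<And>n. child\<^sup>*\<^sup>* s0 (s n)" "\<And>n::nat. child (s n) (s (Suc n))" "\<And>n. R n = t (s n)"
proof -
  have "\<forall>n. \<exists>s. child\<^sup>*\<^sup>* s0 s \<and> R n = t s"
    using assms by (auto simp: ray_from_def V_def image_subset_iff)
  then obtain s where s: "\<And>n. child\<^sup>*\<^sup>* s0 (s n)" "\<And>n. R n = t (s n)"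
    by metis
  moreover have "child (s n) (s (Suc n))" for n
    using tree.parent_ray[OF assms, of n] s vertex_parent_iff by simp
  ultimately show thesis
    using that by blast
qed

end

section \<open>Normal trees around sigma-dispersed sets\<close>

locale dispersed_cover = connectoid_space S \<C> for S :: "'a set" and \<C> +
  fixes U :: "'a set" and f :: "nat \<Rightarrow> 'a set" and x0 :: 'a
  assumes S_connected: "S \<in> \<C>" and x0: "x0 \<in> S" and U_subset: "U \<subseteq> S"
    and cover_dispersed: "\<And>n. dispersed (f n)" and cover_mono: "mono f" and cover: "U \<subseteq> (\<Union>n. f n)"
begin

definition pick :: "'a set \<Rightarrow> 'a" where
  "pick D = (SOME u. u \<in> U \<inter> D \<inter> f (LEAST k. U \<inter> D \<inter> f k \<noteq> {}))"

lemma pick: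
  assumes "u \<in> U \<inter> D"
  shows "pick D \<in> U \<inter> D" and "u \<in> f k \<Longrightarrow> pick D \<in> f k"
proof -
  let ?k = "LEAST k. U \<inter> D \<inter> f k \<noteq> {}"
  have least: "pick D \<in> U \<inter> D \<inter> f ?k \<and> ?k \<le> m" if "u \<in> f m" for m
  proof
    have k: "U \<inter> D \<inter> f m \<noteq> {}"
      using assms that by blast
    then show "?k \<le> m"
      by (rule Least_le)
    from k have "U \<inter> D \<inter> f ?k \<noteq> {}"
      by (rule LeastI)
    then have "\<exists>u. u \<in> U \<inter> D \<inter> f ?k"
      by blast
    then show "pick D \<in> U \<inter> D \<inter> f ?k"
      unfolding pick_def by (rule someI_ex)
  qed
  obtain m where "u \<in> f m"
    using assms cover by blast
  then show "pick D \<in> U \<inter> D"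
    using least by blast
  show "pick D \<in> f k" if "u \<in> f k"
    using least[OF that] monoD[OF cover_mono, of ?k k] by blast
qed

text \<open>
  A state consists of a region and a queue of points of the region that are still to be put into the
  tree; the head of the queue is the current vertex.  Passing to a component \<open>D'\<close> of the rest, the queue
  is restricted to \<open>D'\<close> and extended first by a point of \<open>U\<close> and then by the part in \<open>D'\<close> of
  a finite connected set \<open>bead\<close> that joins the current vertex to the next ones.  As every element of this
  set leaves the region after finitely many steps, the beads along a ray form a necklace.
\<close>

definition pending :: "'a set \<Rightarrow> 'a list \<Rightarrow> 'a list" where
  "pending D' Q = filter (\<lambda>x. x \<in> D') (tl Q) @ (if U \<inter> D' = {} then [] else [pick D'])"

definition bead :: "'a set \<Rightarrow> 'a list \<Rightarrow> 'a set \<Rightarrow> 'a set" where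
  "bead D Q D' = (SOME J. J \<in> \<C> \<and> finite J \<and> insert (hd Q) (set (pending D' Q)) \<subseteq> J \<and> J \<subseteq> D)"

text \<open>A component with nothing pending gets no state, and such a component contains no point
  of \<open>U\<close>. The new queue is a function of the old state and the new region, as
  \<open>child_unique\<close> demands.\<close>

definition child :: "'a set \<times> 'a list \<Rightarrow> 'a set \<times> 'a list \<Rightarrow> bool" where
  "child s s' \<longleftrightarrow> fst s' \<in> comps (fst s - {hd (snd s)}) \<and> pending (fst s') (snd s) \<noteq> [] \<and>
     snd s' = pending (fst s') (snd s) @ (SOME xs. set xs = bead (fst s) (snd s) (fst s') \<inter> fst s')"

definition admissible :: "'a set \<times> 'a list \<Rightarrow> bool" where
  "admissible s \<longleftrightarrow> fst s \<in> \<C> \<and> snd s \<noteq> [] \<and> set (snd s) \<subseteq> fst s"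

lemma set_pending:
  assumes "Q \<noteq> []"
  shows "set (pending D' Q) \<subseteq> D'"
  using pick(1)[of _ D'] by (auto simp: pending_def)

lemma child_admissible:
  assumes "admissible s" "child s s'"
  shows "fst s' \<subseteq> fst s - {hd (snd s)}"
    and "bead (fst s) (snd s) (fst s') \<in> \<C>" "finite (bead (fst s) (snd s) (fst s'))"
    and "insert (hd (snd s)) (set (pending (fst s') (snd s))) \<subseteq> bead (fst s) (snd s) (fst s')"
    and "bead (fst s) (snd s) (fst s') \<subseteq> fst s"
    and "set (snd s') = set (pending (fst s') (snd s)) \<union> bead (fst s) (snd s) (fst s') \<inter> fst s'"
    and "admissible s'"
proof -
  obtain D Q D' Q' where s: "s = (D, Q)" "s' = (D', Q')"
    by (metis surj_pair)
  have D: "D \<in> \<C>" "Q \<noteq> []" "set Q \<subseteq> D"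
    using assms(1) by (simp_all add: admissible_def s)
  have D': "D' \<in> comps (D - {hd Q})" "pending D' Q \<noteq> []"
    and Q': "Q' = pending D' Q @ (SOME xs. set xs = bead D Q D' \<inter> D')"
    using assms(2) by (simp_all add: child_def s)
  show sub: "fst s' \<subseteq> fst s - {hd (snd s)}"
    using component_subset[OF D'(1)] by (simp add: s)
  have pend: "set (pending D' Q) \<subseteq> D'"
    by (rule set_pending[OF D(2)])
  have "insert (hd Q) (set (pending D' Q)) \<subseteq> D"
    using pend sub D(2,3) by (auto simp: s)
  then have "\<exists>J. J \<in> \<C> \<and> finite J \<and> insert (hd Q) (set (pending D' Q)) \<subseteq> J \<and> J \<subseteq> D"
    using finite_connected_superset[OF D(1), of "insert (hd Q) (set (pending D' Q))"]
    by (metis List.finite_set finite_insert insert_not_empty subset_empty)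
  then have "bead D Q D' \<in> \<C> \<and> finite (bead D Q D') \<and>
      insert (hd Q) (set (pending D' Q)) \<subseteq> bead D Q D' \<and> bead D Q D' \<subseteq> D"
    unfolding bead_def by (rule someI_ex)
  then show bead: "bead (fst s) (snd s) (fst s') \<in> \<C>" "finite (bead (fst s) (snd s) (fst s'))"
    "insert (hd (snd s)) (set (pending (fst s') (snd s))) \<subseteq> bead (fst s) (snd s) (fst s')"
    "bead (fst s) (snd s) (fst s') \<subseteq> fst s"
    by (simp_all add: s)
  have "\<exists>xs. set xs = bead D Q D' \<inter> D'"
    using finite_list[of "bead D Q D' \<inter> D'"] bead(2) by (simp add: s)
  then have "set (SOME xs. set xs = bead D Q D' \<inter> D') = bead D Q D' \<inter> D'"
    by (rule someI_ex)
  then show set_Q': "set (snd s') = set (pending (fst s') (snd s)) \<union> bead (fst s) (snd s) (fst s') \<inter> fst s'"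
    by (simp add: s Q')
  show "admissible s'"
    unfolding admissible_def
  proof (intro conjI)
    show "fst s' \<in> \<C>"
      using component_connected[OF D'(1)] by (simp add: s)
    show "snd s' \<noteq> []"
      using D'(2) by (simp add: s Q')
    show "set (snd s') \<subseteq> fst s'"
      unfolding set_Q' using pend by (simp add: s)
  qed
qed

lemma reachable_admissible: "child\<^sup>*\<^sup>* (S, [x0]) s \<Longrightarrow> admissible s"
proof (induction rule: rtranclp_induct)
  case base
  then show ?case
    using S_connected x0 by (simp add: admissible_def)
next
  case (step s s')
  then show ?case
    using child_admissible(7) by metis
qed

sublocale nested_regions S \<C> "(S, [x0])" child fst "\<lambda>s. hd (snd s)"
proof
  show "hd (snd s) \<in> fst s" if "child\<^sup>*\<^sup>* (S, [x0]) s" for s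
    using reachable_admissible[OF that] by (auto simp: admissible_def)
  show "fst s' \<in> comps (fst s - {hd (snd s)})" if "child s s'" for s s'
    using that by (simp add: child_def)
  show "s' = s''" if "child s s'" "child s s''" "fst s' = fst s''" for s s' s''
    using that by (simp add: child_def prod_eq_iff)
qed (use S_connected in simp_all)

section \<open>Branches of the construction and their necklaces\<close>

context
  fixes s :: "nat \<Rightarrow> 'a set \<times> 'a list"
  assumes reach: "\<And>n. child\<^sup>*\<^sup>* (S, [x0]) (s n)" and step: "\<And>n. child (s n) (s (Suc n))"
begin

private abbreviation R where "R n \<equiv> fst (s n)"
private abbreviation Q where "Q n \<equiv> snd (s n)"
private abbreviation J where "J n \<equiv> bead (R n) (Q n) (R (Suc n))"

private lemma state: "admissible (s n)"
  using reachable_admissible[OF reach] .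

private lemmas bead_props = child_admissible[OF state step]

lemma branch_region_mono: "m \<le> n \<Longrightarrow> R n \<subseteq> R m"
  by (rule lift_Suc_antimono_le[of R]) (use bead_props(1) in blast)

text \<open>New points are appended at the end, while the head is removed at every step. So the
  number of entries in front of \<open>x\<close> drops until \<open>x\<close> becomes the current
  vertex and is deleted, unless \<open>x\<close> leaves the region earlier.\<close>

lemma queued_point_leaves: "Q n = xs @ x # ys \<Longrightarrow> \<exists>m. x \<notin> R m"
proof (induction "length xs" arbitrary: n xs ys rule: less_induct)
  case less
  show ?case
  proof (cases xs)
    case Nil
    then have "x = hd (Q n)"
      using less.prems by simp
    then show ?thesis
      using bead_props(1)[of n] by blast
  next
    case (Cons y zs)
    show ?thesis
    proof (cases "x \<in> R (Suc n)")
      case True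
      have "\<exists>us. Q (Suc n) = pending (R (Suc n)) (Q n) @ us"
        using step[of n] by (simp add: child_def)
      moreover have "tl (Q n) = zs @ x # ys"
        using less.prems Cons by simp
      ultimately obtain us where "Q (Suc n) = filter (\<lambda>x. x \<in> R (Suc n)) zs @ x # us"
        using True by (auto simp: pending_def)
      moreover have "length (filter (\<lambda>x. x \<in> R (Suc n)) zs) < length xs"
        using Cons by (simp add: le_imp_less_Suc)
      ultimately show ?thesis
        using less.hyps by blast
    qed blast
  qed
qed

lemma bead_point_leaves:
  assumes "x \<in> (\<Union>n. J n)"
  shows "\<exists>m. \<forall>i\<ge>m. x \<notin> R i"
proof -
  obtain n where n: "x \<in> J n"
    using assms by blast
  have "\<exists>m. x \<notin> R m"
  proof (cases "x \<in> R (Suc n)")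
    case True
    then have "x \<in> set (Q (Suc n))"
      using bead_props(6)[of n] n by blast
    then show ?thesis
      using queued_point_leaves by (meson split_list)
  qed blast
  then show ?thesis
    using branch_region_mono by blast
qed

lemma branch_vertex_in_bead: "hd (Q n) \<in> J n"
  using bead_props(4)[of n] by blast

text \<open>Nonempty \<open>pending\<close> makes consecutive beads meet: the next vertex is its
  first entry and therefore lies in the old bead as well as in the new one.\<close>

lemma branch_necklace: "necklace \<C> (\<Union>n. J n)"
proof (rule necklace_chain[of J])
  show "J n \<inter> J (Suc n) \<noteq> {}" for n
  proof -
    have "pending (R (Suc n)) (Q n) \<noteq> []" "\<exists>us. Q (Suc n) = pending (R (Suc n)) (Q n) @ us"
      using step[of n] by (simp_all add: child_def)
    then have "hd (Q (Suc n)) \<in> set (pending (R (Suc n)) (Q n))"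
      by auto
    then show ?thesis
      using bead_props(4)[of n] branch_vertex_in_bead[of "Suc n"] by blast
  qed
  show "\<exists>m. \<forall>i\<ge>m. x \<notin> J i" if "x \<in> (\<Union>n. J n)" for x
    using bead_point_leaves[OF that] bead_props(5) by blast
qed (use bead_props(2,3) in auto)

text \<open>While a point \<open>u\<close> of \<open>f k\<close> stays in the regions, every step
  queues a point of \<open>f k\<close> and puts it on the necklace. Dispersedness allows only
  finitely many points of \<open>f k\<close> there, and all of these have left the regions after
  some step, so none remains to be picked.\<close>

lemma branch_avoids_U:
  assumes "u \<in> U"
  shows "\<exists>n. u \<notin> R n"
proof (rule ccontr)
  assume "\<not> ?thesis"
  then have u: "u \<in> U \<inter> R n" for n
    using assms by blast
  obtain k where k: "u \<in> f k"
    using assms cover by blast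
  define N where "N = (\<Union>n. J n)"
  have N: "necklace \<C> N"
    unfolding N_def by (rule branch_necklace)
  have leaves: "\<exists>m. \<forall>i\<ge>m. x \<notin> R i" if "x \<in> N" for x
    using bead_point_leaves that unfolding N_def .
  have pick_N: "pick (R (Suc n)) \<in> N \<inter> f k" for n
  proof -
    have "pick (R (Suc n)) \<in> set (pending (R (Suc n)) (Q n))"
      using u[of "Suc n"] by (auto simp: pending_def)
    then show ?thesis
      using bead_props(4)[of n] pick(2)[OF u k] unfolding N_def by blast
  qed
  obtain X where X: "finite X" "\<forall>C\<in>\<C>. C \<inter> X = {} \<and> finite (N - C) \<longrightarrow> C \<inter> f k = {}"
    using cover_dispersed[of k] N unfolding dispersed_def by metis
  obtain N' where N': "necklace \<C> N'" "N' \<subseteq> N" "N' \<inter> X = {}" "finite (N - N')"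
    using necklace_avoiding[OF N X(1)] .
  \<comment> \<open>\<open>N'\<close> itself is a connected set that avoids \<open>X\<close> and
    contains almost all of \<open>N\<close>; so the points of \<open>f k\<close> on \<open>N\<close>
    lie in the finite remainder.\<close>
  have "N' \<inter> f k = {}"
    using X(2) necklace_connected[OF N'(1)] N'(3,4) by simp
  then have "N \<inter> f k \<subseteq> N - N'"
    by blast
  then have fin: "finite (N \<inter> f k)"
    using N'(4) by (rule finite_subset)
  obtain g where g: "\<And>x i. x \<in> N \<Longrightarrow> g x \<le> i \<Longrightarrow> x \<notin> R i"
    using leaves by metis
  obtain m where "\<forall>i\<in>g ` (N \<inter> f k). i \<le> m"
    using fin finite_nat_set_iff_bounded_le[of "g ` (N \<inter> f k)"] by blast
  then have "g (pick (R (Suc m))) \<le> m"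
    using pick_N[of m] by blast
  then have "pick (R (Suc m)) \<notin> R (Suc m)"
    using g pick_N[of m] by (meson IntD1 le_SucI)
  then show False
    using pick(1)[OF u] by blast
qed

end

text \<open>A point of \<open>U\<close> that never becomes a vertex always lies in some component of
  the rest of its region, and following these components gives a branch that
  \<open>branch_avoids_U\<close> forbids.\<close>

lemma U_subset_V: "U \<subseteq> V"
proof
  fix u assume u: "u \<in> U"
  show "u \<in> V"
  proof (rule ccontr)
    assume not: "u \<notin> V"
    have "\<exists>s. \<forall>n. (child\<^sup>*\<^sup>* (S, [x0]) (s n) \<and> u \<in> fst (s n)) \<and> child (s n) (s (Suc n))"
    proof (rule dependent_nat_choice)
      show "\<exists>s. child\<^sup>*\<^sup>* (S, [x0]) s \<and> u \<in> fst s"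
        using u U_subset by (intro exI[of _ "(S, [x0])"]) auto
      fix s and n :: nat
      assume s: "child\<^sup>*\<^sup>* (S, [x0]) s \<and> u \<in> fst s"
      then have "u \<noteq> hd (snd s)"
        using not by (auto simp: V_def)
      moreover have "fst s \<subseteq> S"
        using reachable_admissible s connected_subset by (auto simp: admissible_def)
      ultimately obtain K where K: "K \<in> comps (fst s - {hd (snd s)})" "u \<in> K"
        using component_of_point[of "fst s - {hd (snd s)}" u] s by blast
      \<comment> \<open>The presence of \<open>u\<close> in \<open>K\<close> guarantees a picked
        point, so the branch can be continued into \<open>K\<close>.\<close>
      have "pending K (snd s) \<noteq> []"
        using u K(2) by (auto simp: pending_def)
      then have "\<exists>Q. child s (K, Q)"
        using K(1) by (simp add: child_def)
      then obtain Q where "child s (K, Q)" ..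
      then show "\<exists>s'. (child\<^sup>*\<^sup>* (S, [x0]) s' \<and> u \<in> fst s') \<and> child s s'"
        using s K(2) by (intro exI[of _ "(K, Q)"]) auto
    qed
    then obtain s where "\<And>n. child\<^sup>*\<^sup>* (S, [x0]) (s n)" "\<And>n. u \<in> fst (s n)" "\<And>n. child (s n) (s (Suc n))"
      by metis
    then show False
      using branch_avoids_U[of s u] u by blast
  qed
qed

lemma normal_tree_V: "normal_tree S \<C> V E x0"
  unfolding normal_tree_def
proof (intro conjI allI impI)
  show "weak_normal_tree S \<C> V E x0"
    using nested_weak_normal_tree by simp
  fix R assume "ray_from V E x0 R"
  then have ray: "ray_from V E r R"
    by simp
  obtain s where s: "\<And>n. child\<^sup>*\<^sup>* (S, [x0]) (s n)" "\<And>n. child (s n) (s (Suc n))" "\<And>n. R n = hd (snd (s n))"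
    using nested_tree_ray[OF ray] by metis
  let ?N = "\<Union>n. bead (fst (s n)) (snd (s n)) (fst (s (Suc n)))"
  have "range R \<subseteq> ?N"
    using branch_vertex_in_bead[of s, OF s(1,2)] s(3) by auto
  then have "finite (range R - ?N)"
    by (simp add: Diff_eq_empty_iff[THEN iffD2])
  then show "\<exists>N. necklace \<C> N \<and> finite (range R - N)"
    using branch_necklace[of s, OF s(1,2)] by blast
qed

end

lemma (in connectoid_space) sigma_dispersed_normal_tree:
  assumes "S \<in> \<C>" "S \<noteq> {}" "U \<subseteq> S" "sigma_dispersed U"
  shows "has_normal_tree_containing S \<C> U"
proof -
  obtain x0 where x0: "x0 \<in> S"
    using assms(2) by blast
  obtain f where f: "\<And>n. dispersed (f n)" "mono f" "U \<subseteq> (\<Union>n::nat. f n)"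
    using sigma_dispersed_mono_cover[OF assms(4)] by blast
  interpret dispersed_cover S \<C> U f x0
    using x0 assms(1,3) f by unfold_locales
  show ?thesis
    unfolding has_normal_tree_containing_def using normal_tree_V U_subset_V by blast
qed

section \<open>The local characterisation\<close>

theorem theorem1p2:
  fixes S U :: "'a set" and \<C> :: "'a set set"
  assumes "connected_connectoid S \<C>" and "S \<noteq> {}" and "U \<subseteq> S"
  shows "has_normal_tree_containing S \<C> U \<longleftrightarrow>
    (\<forall>\<omega> \<in> ctd_ends S \<C>. \<exists>X. finite X \<and> X \<subseteq> S \<and>
       has_normal_tree_containing
         (end_component S \<C> X \<omega>)
         (sub_connected_sets \<C> (end_component S \<C> X \<omega>))
         (U \<inter> end_component S \<C> X \<omega>))"
proof
  interpret connectoid_space S \<C>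
    using assms(1) by (auto simp: connected_connectoid_def intro: connectoid_space_connectoid)
  have S: "S \<in> \<C>"
    using assms(1) by (simp add: connected_connectoid_def)
  show "\<forall>\<omega>\<in>ctd_ends S \<C>. \<exists>X. finite X \<and> X \<subseteq> S \<and>
      has_normal_tree_containing (end_component S \<C> X \<omega>)
        (sub_connected_sets \<C> (end_component S \<C> X \<omega>)) (U \<inter> end_component S \<C> X \<omega>)"
    if T: "has_normal_tree_containing S \<C> U"
  proof
    fix \<omega> assume "\<omega> \<in> ctd_ends S \<C>"
    \<comment> \<open>Deleting nothing is enough in this direction: as \<open>S\<close> is
      connected, the given tree itself serves every end.\<close>
    then have "end_component S \<C> {} \<omega> = S"
      by (rule end_component_empty[OF S])
    then show "\<exists>X. finite X \<and> X \<subseteq> S \<and> has_normal_tree_containing (end_component S \<C> X \<omega>)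
        (sub_connected_sets \<C> (end_component S \<C> X \<omega>)) (U \<inter> end_component S \<C> X \<omega>)"
      using T assms(3)
      by (intro exI[of _ "{}"]) (simp add: sub_connected_sets_whole Int_absorb2)
  qed
  show "has_normal_tree_containing S \<C> U"
    if local: "\<forall>\<omega>\<in>ctd_ends S \<C>. \<exists>X. finite X \<and> X \<subseteq> S \<and>
      has_normal_tree_containing (end_component S \<C> X \<omega>)
        (sub_connected_sets \<C> (end_component S \<C> X \<omega>)) (U \<inter> end_component S \<C> X \<omega>)"
  proof (rule sigma_dispersed_normal_tree[OF S assms(2,3)], rule sigma_dispersed_local[OF S _ assms(3)])
    fix N assume N: "necklace \<C> N"
    let ?\<omega> = "necklace_equiv S \<C> `` {N}"
    obtain X where X: "finite X" "X \<subseteq> S" and T: "has_normal_tree_containing (end_component S \<C> X ?\<omega>)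
        (sub_connected_sets \<C> (end_component S \<C> X ?\<omega>)) (U \<inter> end_component S \<C> X ?\<omega>)"
      using local necklace_class_in_ends[OF N] by metis
    have "N - X \<subseteq> S - X"
      using necklace_subset[OF N] by blast
    then obtain K where K: "K \<in> comps (S - X)" "finite (N - K)"
      using tail_component[OF N X(1)] by metis
    have "sigma_dispersed (U \<inter> K)"
      using sub_normal_tree_sigma_dispersed[OF K(1) X(1)] T end_component_eq[OF N X K] by simp
    then show "\<exists>X. finite X \<and> (\<exists>K\<in>comps (S - X). finite (N - K) \<and> sigma_dispersed (U \<inter> K))"
      using X(1) K by blast
  qed
qed

end
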